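(* Let $\alpha\in(0,1/4)$, let $D=D_n\le n$, let $a>0$, and let $\mathcal P$ be the class of distributions $N(0,\Sigma)$ of a random vector $W\in\mathbb R^D$ with $\Sigma\in\mathcal S_a$. Let $\theta$ be the partial correlation between the two components $W_D$ and $W_{D-1}$ of $W$ given the remaining components, and let $\mathcal C_n$ be the set of $1-\alpha$ confidence intervals for $\theta$ based on $n$ i.i.d. draws of $W$. Then there is a constant $C>0$, not depending on $n$, such that $$\inf_{C_n\in\mathcal C_n}\ \sup_{P\in\mathcal P}\ \mathbb E(W_n^2)\ \ge\ \frac{C}{n-D+1},$$ where $W_n$ denotes the width of $C_n$.
   Context: $\mathcal S_a$ is the set of symmetric $D\times D$ matrices $\Sigma$ with $\lambda_{\min}(\Sigma)\ge a$. With $\Omega=\Sigma^{-1}$, the partial correlation between components $j$ and $k$ given all the others is $\theta_{jk}=-\Omega_{jk}/\sqrt{\Omega_{jj}\Omega_{kk}}$; here $\theta=\theta_{D,D-1}$. $P^n$ is the law of $n$ i.i.d. observations from $P$. A set-valued function $C_n$ of the data is a $1-\alpha$ confidence interval for $\theta$ if $P^n(\theta\in C_n)\ge1-\alpha$ for all $P\in\mathcal P$. The width is the random variable $W_n=\sup\{x:x\in C_n\}-\inf\{x:x\in C_n\}$ (not to be confused with the data vector $W$). The dimension $D=D_n$ may depend on $n$. *)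

theory Defs
  imports "HOL-Probability.Probability" "Jordan_Normal_Form.Spectral_Radius"
begin

definition lambda_min :: "real mat \<Rightarrow> real" where
  "lambda_min A = Min (spectrum A)"

definition cov_class :: "nat \<Rightarrow> real \<Rightarrow> real mat set" where
  "cov_class D a =
     {\<Sigma> \<in> carrier_mat D D. transpose_mat \<Sigma> = \<Sigma> \<and> a \<le> lambda_min \<Sigma>}"

(* mat_inverse returns an option; it is Some for every invertible square matrix,
   in particular for every matrix in cov_class D a when a > 0. *)
definition precision :: "real mat \<Rightarrow> real mat" where
  "precision \<Sigma> = the (mat_inverse \<Sigma>)"

definition pcorr :: "real mat \<Rightarrow> nat \<Rightarrow> nat \<Rightarrow> real" where
  "pcorr \<Sigma> j k =
     - precision \<Sigma> $$ (j, k) / sqrt (precision \<Sigma> $$ (j, j) * precision \<Sigma> $$ (k, k))"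

(* Coordinates are numbered from 0, so W_D and W_(D-1) have indices D - 1 and D - 2. *)
definition theta :: "nat \<Rightarrow> real mat \<Rightarrow> real" where
  "theta D \<Sigma> = pcorr \<Sigma> (D - 1) (D - 2)"

(* Since D varies with the sample size, a vector of R^D is an extensional function on {..<D}.
   The density below is that of N(0, \<Sigma>) for positive definite \<Sigma>. *)
definition mvn_density :: "nat \<Rightarrow> real mat \<Rightarrow> (nat \<Rightarrow> real) \<Rightarrow> real" where
  "mvn_density D \<Sigma> x =
     exp (- (\<Sum>j<D. \<Sum>k<D. x j * precision \<Sigma> $$ (j, k) * x k) / 2)
       / sqrt ((2 * pi) ^ D * Determinant.det \<Sigma>)"

definition mvn :: "nat \<Rightarrow> real mat \<Rightarrow> (nat \<Rightarrow> real) measure" where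
  "mvn D \<Sigma> = density (\<Pi>\<^sub>M j\<in>{..<D}. lborel) (\<lambda>x. ennreal (mvn_density D \<Sigma> x))"

definition sample_law :: "nat \<Rightarrow> nat \<Rightarrow> real mat \<Rightarrow> (nat \<Rightarrow> nat \<Rightarrow> real) measure" where
  "sample_law n D \<Sigma> = (\<Pi>\<^sub>M i\<in>{..<n}. mvn D \<Sigma>)"

definition sample_space :: "nat \<Rightarrow> nat \<Rightarrow> (nat \<Rightarrow> nat \<Rightarrow> real) measure" where
  "sample_space n D = (\<Pi>\<^sub>M i\<in>{..<n}. \<Pi>\<^sub>M j\<in>{..<D}. borel)"

(* sup - inf, taken in the extended reals: unbounded sets have infinite width,
   and e2ennreal gives the empty set width 0. *)
definition width :: "real set \<Rightarrow> ennreal" where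
  "width S = e2ennreal (Sup (ereal ` S) - Inf (ereal ` S))"

definition conf_sets ::
  "real \<Rightarrow> real \<Rightarrow> nat \<Rightarrow> nat \<Rightarrow> ((nat \<Rightarrow> nat \<Rightarrow> real) \<Rightarrow> real set) set" where
  "conf_sets \<alpha> a n D =
     {C. (\<lambda>X. width (C X)) \<in> borel_measurable (sample_space n D) \<and>
         (\<forall>\<Sigma>\<in>cov_class D a.
            {X \<in> space (sample_space n D). theta D \<Sigma> \<in> C X} \<in> sets (sample_space n D) \<and>
            1 - \<alpha> \<le> measure (sample_law n D \<Sigma>)
                      {X \<in> space (sample_space n D). theta D \<Sigma> \<in> C X})}"

lemma space_sample_law: "space (sample_law n D \<Sigma>) = space (sample_space n D)"
  by (simp add: sample_law_def sample_space_def mvn_def space_PiM)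

lemma sets_sample_law: "sets (sample_law n D \<Sigma>) = sets (sample_space n D)"
  unfolding sample_law_def sample_space_def
  by (rule sets_PiM_cong) (auto simp: mvn_def cong: sets_PiM_cong)

lemma width_empty [simp]: "width {} = 0"
  by (simp add: width_def bot_ereal_def top_ereal_def e2ennreal_neg)

lemma width_atLeastAtMost: "l \<le> u \<Longrightarrow> width {l..u} = ennreal (u - l)"
proof -
  assume "l \<le> u"
  then have "Sup (ereal ` {l..u}) = ereal u" "Inf (ereal ` {l..u}) = ereal l"
    by (auto intro!: Sup_eqI Inf_eqI)
  then show ?thesis
    by (simp add: width_def e2ennreal_ereal)
qed

end

theory Submission
  imports Defs
begin

text \<open>
  Put \<open>k = D - 2\<close> and let the regressors \<open>Z = (W\<^sub>1, \<dots>, W\<^sub>k)\<close> and \<open>x = W\<^sub>D\<^sub>-\<^sub>1\<close> have independent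
  \<open>N(0, s)\<close> coordinates, and let \<open>W\<^sub>D = Z b + (\<beta> / \<surd>s) x + \<epsilon>\<close> with \<open>\<epsilon> \<sim> N(0, t)\<close>.
  The partial correlation is \<open>\<beta> / \<surd>(t + \<beta>\<^sup>2)\<close>, whatever \<open>b\<close> and \<open>s\<close> are. Le Cam's method compares
  \<open>\<beta> = 0\<close> with \<open>\<beta>\<^sup>2 / t = 1 / (64 (n - k))\<close>, both mixed over \<open>b\<close> uniform on the unit cube.
  After dividing the regressors by \<open>\<surd>s\<close>, for every \<open>w\<close> we have \<open>\<beta> x = Z (\<beta> w) + \<beta> (x - Z w)\<close>.
  The first part is a translation of \<open>b\<close> by \<open>\<beta> w / \<surd>s\<close>, which becomes invisible as \<open>s \<rightarrow> \<infinity>\<close>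
  (only the smallest eigenvalue of \<open>\<Sigma>\<close> is restricted), so only the Gaussian translation by
  \<open>\<beta> (x - Z w)\<close> remains. For the least-squares \<open>w\<close> the squared residual has mean \<open>n - k\<close>,
  which yields the rate \<open>1 / (n - D + 2)\<close>.
\<close>

text \<open>Mixing over \<open>b\<close> is what replaces n by n - k in the rate: for a known
  \<open>b\<close> all n rows would inform about \<beta>, whereas an unknown \<open>b\<close>
  absorbs the part of \<open>x\<close> spanned by \<open>Z\<close>. The order of choices is the
  obstacle. The best \<open>w\<close> depends on the design, a single \<open>s\<close> has to serve
  all designs, and the event on which the mixtures are compared is fixed before \<open>s\<close>. So
  the comparison is made conditionally on the design, its limit superior in \<open>s\<close> is
  bounded for every \<open>w\<close> at once, and reverse Fatou returns one finite \<open>s\<close>.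
  The prior on \<open>b\<close> has bounded support because t must dominate a (1 + 2 |v|^2) to keep
  the smallest eigenvalue above a. Thus t grows with k, at no cost, since only
  \<open>\<beta>\<^sup>2 / t\<close> enters the partial correlation. Constants: given the design,
  the noise translation costs 1/8 plus 4 \<open>\<beta>\<^sup>2 / t\<close> times the squared
  residual, whose mean contributes at most 1/16. The sum stays below 1/4, and \<alpha> < 1/4 leaves
  the fraction 1 - 2 \<alpha> - 1/4 > 1/4 of the squared separation.\<close>

section \<open>Covariance matrices of a Gaussian linear regression\<close>

text \<open>Law of \<open>p\<close> independent \<open>N(0, s)\<close> regressors followed by their linear combination with
  coefficients \<open>v\<close> plus independent \<open>N(0, t)\<close> noise.\<close>

definition rcov :: "nat \<Rightarrow> real \<Rightarrow> real \<Rightarrow> (nat \<Rightarrow> real) \<Rightarrow> real mat" where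
  "rcov p s t v = mat (Suc p) (Suc p) (\<lambda>(i, j).
     if i < p then if j < p then (if i = j then s else 0) else s * v i
     else if j < p then s * v j else s * (\<Sum>l<p. (v l)\<^sup>2) + t)"

text \<open>The coefficients of the quadratic form sum_j x_j^2 / s + (x_p - sum_j v_j x_j)^2 / t,
  which is -2 times the exponent of the joint density of regressors and response.\<close>

definition rprec :: "nat \<Rightarrow> real \<Rightarrow> real \<Rightarrow> (nat \<Rightarrow> real) \<Rightarrow> real mat" where
  "rprec p s t v = mat (Suc p) (Suc p) (\<lambda>(i, j).
     if i < p then if j < p then (if i = j then 1 / s else 0) + v i * v j / t else - v i / t
     else if j < p then - v j / t else 1 / t)"

lemma rcov_carrier [simp]: "rcov p s t v \<in> carrier_mat (Suc p) (Suc p)"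
  by (simp add: rcov_def)

lemma rprec_carrier [simp]: "rprec p s t v \<in> carrier_mat (Suc p) (Suc p)"
  by (simp add: rprec_def)

lemma rcov_mult_rprec:
  assumes "0 < s" "0 < t"
  shows "rcov p s t v * rprec p s t v = 1\<^sub>m (Suc p)"
proof (rule eq_matI)
  fix i j assume "i < dim_row (1\<^sub>m (Suc p) :: real mat)" "j < dim_col (1\<^sub>m (Suc p) :: real mat)"
  then have ij: "i < Suc p" "j < Suc p" by auto
  have *: "(rcov p s t v * rprec p s t v) $$ (i, j) =
     (\<Sum>l<Suc p. rcov p s t v $$ (i, l) * rprec p s t v $$ (l, j))"
    using ij by (simp add: scalar_prod_def rcov_def rprec_def atLeast0LessThan)
  show "(rcov p s t v * rprec p s t v) $$ (i, j) = 1\<^sub>m (Suc p) $$ (i, j)"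
  proof (cases "i < p")
    case True
    have "(\<Sum>l<p. (if i = l then s else 0) * rprec p s t v $$ (l, j)) = s * rprec p s t v $$ (i, j)"
      using True by (simp add: if_distrib[of "\<lambda>x. x * _"] sum.delta cong: if_cong)
    then have "(rcov p s t v * rprec p s t v) $$ (i, j) = s * rprec p s t v $$ (i, j) + s * v i * rprec p s t v $$ (p, j)"
      unfolding * using ij True by (simp add: rcov_def)
    then show ?thesis using ij True assms by (auto simp: rprec_def field_simps)
  next
    case False
    then have i: "i = p" using ij by simp
    have "(rcov p s t v * rprec p s t v) $$ (i, j) =
      (\<Sum>l<p. s * v l * rprec p s t v $$ (l, j)) + (s * (\<Sum>l<p. (v l)\<^sup>2) + t) * rprec p s t v $$ (p, j)"
      unfolding * using ij by (simp add: rcov_def i)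
    also have "\<dots> = (if j = p then 1 else 0)"
    proof (cases "j = p")
      case True
      then show ?thesis using assms
        by (simp add: rprec_def sum_negf sum_distrib_left sum_divide_distrib power2_eq_square field_simps)
    next
      case False
      with ij have j: "j < p" by simp
      have "(\<Sum>l<p. s * v l * rprec p s t v $$ (l, j)) =
        (\<Sum>l<p. (if l = j then v l else 0) + (v l)\<^sup>2 * (s * v j / t))"
        using j assms by (intro sum.cong) (auto simp: rprec_def power2_eq_square field_simps)
      also have "\<dots> = v j + (\<Sum>l<p. (v l)\<^sup>2) * (s * v j / t)"
        using j by (simp add: sum.distrib sum_distrib_right sum_divide_distrib)
      finally show ?thesis using j assms by (simp add: rprec_def field_simps)
    qed
    finally show ?thesis using ij i by auto
  qed
qed (auto simp: rcov_def rprec_def)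

text \<open>\<open>precision\<close> unpacks an option, so two things are needed: a right inverse
  makes \<open>S\<close> a unit of the matrix ring, hence the option is \<open>Some\<close>, and
  inverses are unique.\<close>

lemma precision_eqI:
  assumes S: "S \<in> carrier_mat n n" and Q: "Q \<in> carrier_mat n n" and SQ: "S * Q = 1\<^sub>m n"
  shows "precision S = Q"
proof -
  have QS: "Q * S = 1\<^sub>m n"
    using mat_mult_left_right_inverse[OF S Q SQ] .
  have "S \<in> Units (ring_mat TYPE(real) n ())"
    unfolding Units_def using assms QS by (auto simp: ring_mat_def)
  then obtain B where B: "mat_inverse S = Some B"
    using mat_inverse(1)[OF S, where b = "()"] by (cases "mat_inverse S") auto
  from mat_inverse(2)[OF S B] have "B * S = 1\<^sub>m n" "B \<in> carrier_mat n n" by auto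
  then have "B * (S * Q) = Q"
    using Q by (simp add: assoc_mult_mat[symmetric, OF _ S Q])
  then have "B = Q"
    using \<open>B \<in> carrier_mat n n\<close> by (simp add: SQ)
  then show ?thesis by (simp add: precision_def B)
qed

lemma precision_rcov:
  assumes "0 < s" "0 < t"
  shows "precision (rcov p s t v) = rprec p s t v"
  by (rule precision_eqI[OF rcov_carrier rprec_carrier rcov_mult_rprec[OF assms]])

lemma det_rcov: "Determinant.det (rcov p s t v) = s ^ p * t"
proof -
  \<comment> \<open>Left multiplication by \<open>L\<close> subtracts \<open>v j\<close> times row j
    from the last row for all j < p. What remains is upper triangular with diagonal s, ..., s,
    t.\<close>
  define L where "L = mat (Suc p) (Suc p) (\<lambda>(i, j). if i = j then 1 else if i = p then - v j else 0)"
  have L: "L \<in> carrier_mat (Suc p) (Suc p)" by (simp add: L_def)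
  have "Determinant.det L = prod_list (diag_mat L)"
    by (rule det_lower_triangular[OF _ L]) (auto simp: L_def)
  also have "diag_mat L = map (\<lambda>_. 1) [0..<Suc p]"
    by (auto simp: diag_mat_def L_def)
  finally have dL: "Determinant.det L = 1" by (simp add: prod_list_replicate map_replicate_const del: upt_Suc)
  have ent: "(L * rcov p s t v) $$ (i, j) =
      (if i < p then rcov p s t v $$ (i, j) else if j < p then 0 else t)"
    if ij: "i < Suc p" "j < Suc p" for i j
  proof -
    have *: "(L * rcov p s t v) $$ (i, j) = (\<Sum>l<Suc p. L $$ (i, l) * rcov p s t v $$ (l, j))"
      using ij by (simp add: scalar_prod_def rcov_def L_def atLeast0LessThan)
    show ?thesis
    proof (cases "i < p")
      case True
      then show ?thesis unfolding * using ij
        by (simp add: L_def if_distrib[of "\<lambda>x. x * _"] sum.delta cong: if_cong)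
    next
      case False
      then have i: "i = p" using ij by simp
      have "(\<Sum>l<Suc p. L $$ (i, l) * rcov p s t v $$ (l, j)) =
        (\<Sum>l<p. - v l * rcov p s t v $$ (l, j)) + rcov p s t v $$ (p, j)"
        using i by (simp add: L_def)
      also have "\<dots> = (if j < p then 0 else t)"
      proof (cases "j < p")
        case True
        then have "(\<Sum>l<p. - v l * rcov p s t v $$ (l, j)) = (\<Sum>l<p. if l = j then - s * v l else 0)"
          by (intro sum.cong) (auto simp: rcov_def)
        then show ?thesis using True by (simp add: rcov_def)
      next
        case False
        then show ?thesis using ij
          by (simp add: rcov_def sum_negf sum_distrib_left power2_eq_square mult_ac)
      qed
      finally show ?thesis using i * by simp
    qed
  qed
  have LR: "L * rcov p s t v \<in> carrier_mat (Suc p) (Suc p)"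
    using L by (intro mult_carrier_mat[of _ _ "Suc p"]) auto
  have "Determinant.det (L * rcov p s t v) = prod_list (diag_mat (L * rcov p s t v))"
  proof (rule det_upper_triangular[OF _ LR])
    show "upper_triangular (L * rcov p s t v)"
    proof
      fix i j assume "j < i" "i < dim_row (L * rcov p s t v)"
      then have ij: "i < Suc p" "j < Suc p" "j < p" "j \<noteq> i" using LR by auto
      show "(L * rcov p s t v) $$ (i, j) = 0"
        unfolding ent[OF ij(1,2)] using ij by (auto simp: rcov_def)
    qed
  qed
  also have "diag_mat (L * rcov p s t v) = map (\<lambda>_. s) [0..<p] @ [t]"
  proof -
    have d: "dim_row (L * rcov p s t v) = Suc p" using LR by auto
    have "diag_mat (L * rcov p s t v) = map (\<lambda>i. (L * rcov p s t v) $$ (i, i)) [0..<Suc p]"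
      unfolding diag_mat_def d by simp
    also have "\<dots> = map (\<lambda>i. if i < p then s else t) [0..<Suc p]"
      by (rule map_cong[OF refl], subst ent) (auto simp: rcov_def)
    finally show ?thesis by simp
  qed
  finally have "Determinant.det (L * rcov p s t v) = s ^ p * t"
    by (simp add: prod_list_replicate map_replicate_const)
  then show ?thesis
    using dL by (simp add: det_mult[OF L rcov_carrier])
qed

text \<open>Completing the square in the last coordinate leaves only diagonal terms in the others:
  the density is that of the regressors times the conditional density of the response.\<close>

lemma mvn_density_rcov:
  assumes "0 < s" "0 < t"
  shows "mvn_density (Suc p) (rcov p s t v) x =
    (\<Prod>j<p. normal_density 0 (sqrt s) (x j)) * normal_density (\<Sum>j<p. v j * x j) (sqrt t) (x p)"
proof -
  define m where "m = (\<Sum>j<p. v j * x j)"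
  have "(\<Sum>j<Suc p. \<Sum>k<Suc p. x j * rprec p s t v $$ (j, k) * x k) =
    (\<Sum>j<p. \<Sum>k<p. x j * ((if j = k then 1 / s else 0) + v j * v k / t) * x k)
     + (\<Sum>j<p. x j * (- v j / t) * x p) + (\<Sum>k<p. x p * (- v k / t) * x k) + x p * (1 / t) * x p"
    by (simp add: rprec_def sum.distrib)
  also have "(\<Sum>j<p. \<Sum>k<p. x j * ((if j = k then 1 / s else 0) + v j * v k / t) * x k)
      = (\<Sum>j<p. (x j)\<^sup>2 / s + (v j * x j) * m / t)"
  proof (intro sum.cong refl)
    fix j assume j: "j \<in> {..<p}"
    have "(\<Sum>k<p. x j * ((if j = k then 1 / s else 0) + v j * v k / t) * x k)
       = (\<Sum>k<p. (if j = k then (x j)\<^sup>2 / s else 0) + (v j * x j) * (v k * x k) / t)"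
      by (intro sum.cong refl) (auto simp: power2_eq_square field_simps)
    also have "\<dots> = (x j)\<^sup>2 / s + (v j * x j) * m / t"
      using j by (simp add: sum.distrib m_def sum_distrib_left sum_divide_distrib)
    finally show "(\<Sum>k<p. x j * ((if j = k then 1 / s else 0) + v j * v k / t) * x k) = \<dots>" .
  qed
  also have "\<dots> = (\<Sum>j<p. (x j)\<^sup>2 / s) + m * m / t"
    by (simp add: sum.distrib m_def sum_distrib_right sum_divide_distrib)
  also have "(\<Sum>j<p. x j * (- v j / t) * x p) = - m * x p / t"
    unfolding m_def sum_negf[symmetric] sum_distrib_right sum_divide_distrib
    by (intro sum.cong) auto
  also have "(\<Sum>k<p. x p * (- v k / t) * x k) = - m * x p / t"
    unfolding m_def sum_negf[symmetric] sum_distrib_right sum_divide_distrib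
    by (intro sum.cong) auto
  also have "(\<Sum>j<p. (x j)\<^sup>2 / s) + m * m / t + - m * x p / t + - m * x p / t + x p * (1 / t) * x p
      = (\<Sum>j<p. (x j)\<^sup>2 / s) + (x p - m)\<^sup>2 / t"
    by (simp add: power2_eq_square diff_divide_distrib add_divide_distrib algebra_simps)
  finally have Q: "(\<Sum>j<Suc p. \<Sum>k<Suc p. x j * rprec p s t v $$ (j, k) * x k) =
      (\<Sum>j<p. (x j)\<^sup>2 / s) + (x p - m)\<^sup>2 / t" .
  have c: "sqrt ((2 * pi) ^ Suc p * (s ^ p * t)) = (\<Prod>j<p. sqrt (2 * pi * s)) * sqrt (2 * pi * t)"
    using assms by (simp add: real_sqrt_mult real_sqrt_power power_mult_distrib)
  have "mvn_density (Suc p) (rcov p s t v) x =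
     exp (- ((\<Sum>j<p. (x j)\<^sup>2 / s) + (x p - m)\<^sup>2 / t) / 2) / sqrt ((2 * pi) ^ Suc p * (s ^ p * t))"
    unfolding mvn_density_def precision_rcov[OF assms] det_rcov Q ..
  also have "- ((\<Sum>j<p. (x j)\<^sup>2 / s) + (x p - m)\<^sup>2 / t) / 2 =
     (\<Sum>j<p. - (x j)\<^sup>2 / (2 * s)) + - (x p - m)\<^sup>2 / (2 * t)"
    by (simp add: sum_negf sum_divide_distrib diff_divide_distrib mult.commute)
  also have "exp \<dots> = (\<Prod>j<p. exp (- (x j)\<^sup>2 / (2 * s))) * exp (- (x p - m)\<^sup>2 / (2 * t))"
    by (simp only: exp_add exp_sum finite_lessThan)
  finally show ?thesis
    unfolding c using assms
    by (simp add: normal_density_def m_def prod_dividef real_sqrt_mult)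
qed

section \<open>Eigenvalues of the regression covariance\<close>

lemma rcov_mult_vec:
  assumes "u \<in> carrier_vec (Suc p)" "i < Suc p"
  shows "(rcov p s t v *\<^sub>v u) $ i =
    (if i < p then s * (u $ i + v i * u $ p)
     else s * (\<Sum>l<p. v l * (u $ l + v l * u $ p)) + t * u $ p)"
proof -
  have *: "(rcov p s t v *\<^sub>v u) $ i = (\<Sum>l<Suc p. rcov p s t v $$ (i, l) * u $ l)"
    using assms by (simp add: scalar_prod_def rcov_def atLeast0LessThan)
  show ?thesis
  proof (cases "i < p")
    case True
    then show ?thesis unfolding * using assms
      by (simp add: rcov_def if_distrib[of "\<lambda>x. x * _"] sum.delta distrib_left cong: if_cong)
  next
    case False
    then have "i = p" using assms by simp
    then show ?thesis unfolding * using assms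
      by (simp add: rcov_def sum.distrib sum_distrib_left sum_distrib_right power2_eq_square algebra_simps)
  qed
qed

text \<open>\<open>lambda_min\<close> is a \<open>Min\<close>, which says nothing for an empty
  spectrum. An eigenvector is therefore exhibited, of the form (v, r): the first p rows force the
  eigenvalue s (1 + r), and the last row becomes a quadratic equation for r. If v = 0 this vector
  may vanish, and the last unit vector is taken instead.\<close>

lemma rcov_eigenvalue_ex:
  assumes s: "0 < s" and t: "0 < t"
  shows "\<exists>l. eigenvalue (rcov p s t v) l"
proof (cases "\<forall>l<p. v l = 0")
  case True
  have "eigenvector (rcov p s t v) (unit_vec (Suc p) p) t"
    unfolding eigenvector_def
  proof (intro conjI)
    show "rcov p s t v *\<^sub>v unit_vec (Suc p) p = t \<cdot>\<^sub>v unit_vec (Suc p) p"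
      by (rule eq_vecI) (use True in \<open>auto simp: rcov_mult_vec simp del: index_mult_mat_vec\<close>, simp add: rcov_def)
  qed (auto simp: rcov_def)
  then show ?thesis by (auto simp: eigenvalue_def)
next
  case False
  then obtain l0 where l0: "l0 < p" "v l0 \<noteq> 0" by blast
  define V where "V = (\<Sum>l<p. (v l)\<^sup>2)"
  have V: "0 \<le> V" by (simp add: V_def sum_nonneg)
  \<comment> \<open>The last row demands \<open>s * r\<^sup>2 + B * r = s * V\<close>. The
    discriminant is nonnegative, and r is the larger root.\<close>
  define B where "B = s - s * V - t"
  define r where "r = (- B + sqrt (B\<^sup>2 + 4 * s * (s * V))) / (2 * s)"
  have "(sqrt (B\<^sup>2 + 4 * s * (s * V)))\<^sup>2 = B\<^sup>2 + 4 * s * (s * V)"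
    using V s by (intro real_sqrt_pow2) auto
  moreover have "sqrt (B\<^sup>2 + 4 * s * (s * V)) = 2 * s * r + B"
    using s by (simp add: r_def)
  ultimately have "(2 * s * r + B)\<^sup>2 = B\<^sup>2 + 4 * s * (s * V)" by simp
  then have "4 * s * (s * r\<^sup>2 + B * r) = 4 * s * (s * V)"
    by (simp add: power2_eq_square algebra_simps)
  then have r: "s * r\<^sup>2 + B * r = s * V" using s by simp
  define u where "u = vec (Suc p) (\<lambda>i. if i < p then v i else r)"
  have "eigenvector (rcov p s t v) u (s * (1 + r))"
    unfolding eigenvector_def
  proof (intro conjI)
    show "u \<noteq> 0\<^sub>v (dim_row (rcov p s t v))"
    proof
      assume "u = 0\<^sub>v (dim_row (rcov p s t v))"
      then have "u $ l0 = 0" using l0 by (simp add: rcov_def)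
      then show False using l0 by (simp add: u_def)
    qed
    have u: "u \<in> carrier_vec (Suc p)" by (simp add: u_def)
    show "rcov p s t v *\<^sub>v u = s * (1 + r) \<cdot>\<^sub>v u"
    proof (rule eq_vecI)
      fix i assume "i < dim_vec (s * (1 + r) \<cdot>\<^sub>v u)"
      then have i: "i < Suc p" by (simp add: u_def)
      have "s * (\<Sum>l<p. v l * (u $ l + v l * u $ p)) = s * V * (1 + r)"
        by (simp add: u_def V_def sum_distrib_right sum_distrib_left power2_eq_square algebra_simps)
      moreover have "s * V * (1 + r) + t * r = s * (1 + r) * r"
        using r by (simp add: B_def power2_eq_square algebra_simps)
      ultimately show "(rcov p s t v *\<^sub>v u) $ i = (s * (1 + r) \<cdot>\<^sub>v u) $ i"
        unfolding rcov_mult_vec[OF u i] using i by (auto simp: u_def algebra_simps)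
    qed (simp add: rcov_def u_def)
  qed (auto simp: rcov_def u_def)
  then show ?thesis by (auto simp: eigenvalue_def)
qed

text \<open>For an eigenvector u with last entry w, the form u' \<Sigma> u equals s sum_i (u_i + v_i
  w)^2 + t w^2. Since 2 (u_i + v_i w)^2 is at least u_i^2 - 2 v_i^2 w^2, the regressors yield a
  u_i^2 up to a deficit, which the summand 2 a |v|^2 in the bound on t repays.\<close>

lemma rcov_in_cov_class:
  assumes a: "0 < a" and s: "2 * a \<le> s" and t: "a * (1 + 2 * (\<Sum>l<p. (v l)\<^sup>2)) \<le> t"
  shows "rcov p s t v \<in> cov_class (Suc p) a"
proof -
  have V: "0 \<le> (\<Sum>l<p. (v l)\<^sup>2)" by (simp add: sum_nonneg)
  have s0: "0 < s" using a s by simp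
  have t0: "0 < t" using a t V by (smt (verit) mult_pos_pos)
  have "transpose_mat (rcov p s t v) = rcov p s t v"
    by (rule eq_matI) (auto simp: rcov_def)
  moreover have "a \<le> l" if "l \<in> spectrum (rcov p s t v)" for l
  proof -
    from that obtain u where "eigenvector (rcov p s t v) u l"
      by (auto simp: spectrum_def eigenvalue_def)
    then have u: "u \<in> carrier_vec (Suc p)" "u \<noteq> 0\<^sub>v (Suc p)" "rcov p s t v *\<^sub>v u = l \<cdot>\<^sub>v u"
      by (auto simp: eigenvector_def rcov_def)
    define U where "U = vec_index u"
    define w where "w = U p"
    define N where "N = (\<Sum>i<Suc p. (U i)\<^sup>2)"
    obtain i where "i < Suc p" "U i \<noteq> 0" using u(1,2) by (auto simp: vec_eq_iff U_def)
    then have N: "0 < N" unfolding N_def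
      by (intro sum_pos2[of _ i]) auto
    have "l * N = (\<Sum>i<Suc p. U i * vec_index (rcov p s t v *\<^sub>v u) i)"
      unfolding u(3) N_def sum_distrib_left U_def
      using u(1) by (intro sum.cong) (auto simp: power2_eq_square)
    also have "\<dots> = (\<Sum>i<p. U i * (s * (U i + v i * w))) +
       w * (s * (\<Sum>l<p. v l * (U l + v l * w)) + t * w)"
      by (simp add: rcov_mult_vec[OF u(1)] U_def w_def del: index_mult_mat_vec)
    also have "\<dots> = (\<Sum>i<p. U i * (s * (U i + v i * w)) + w * (s * (v i * (U i + v i * w)))) + t * w\<^sup>2"
      by (simp only: sum.distrib sum_distrib_left distrib_left[of w] power2_eq_square add.assoc mult.left_commute[of w t w])
    also have "(\<Sum>i<p. U i * (s * (U i + v i * w)) + w * (s * (v i * (U i + v i * w)))) =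
        (\<Sum>i<p. s * (U i + v i * w)\<^sup>2)"
      by (intro sum.cong refl) (simp add: power2_eq_square algebra_simps)
    also have "(\<Sum>i<p. s * (U i + v i * w)\<^sup>2) + t * w\<^sup>2 \<ge> (\<Sum>i<p. a * (U i)\<^sup>2 - 2 * a * (v i)\<^sup>2 * w\<^sup>2) + a * (1 + 2 * (\<Sum>l<p. (v l)\<^sup>2)) * w\<^sup>2"
    proof (intro add_mono sum_mono mult_right_mono t)
      fix i
      have "0 \<le> a * (U i + 2 * (v i * w))\<^sup>2" using a by simp
      also have "\<dots> = 2 * a * (U i + v i * w)\<^sup>2 - (a * (U i)\<^sup>2 - 2 * a * (v i)\<^sup>2 * w\<^sup>2)"
        by (simp add: power2_eq_square algebra_simps)
      finally have "a * (U i)\<^sup>2 - 2 * a * (v i)\<^sup>2 * w\<^sup>2 \<le> 2 * a * (U i + v i * w)\<^sup>2"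
        by simp
      also have "2 * a * (U i + v i * w)\<^sup>2 \<le> s * (U i + v i * w)\<^sup>2"
        using s by (intro mult_right_mono) auto
      finally show "a * (U i)\<^sup>2 - 2 * a * (v i)\<^sup>2 * w\<^sup>2 \<le> s * (U i + v i * w)\<^sup>2" .
    qed simp
    also have "(\<Sum>i<p. a * (U i)\<^sup>2 - 2 * a * (v i)\<^sup>2 * w\<^sup>2) + a * (1 + 2 * (\<Sum>l<p. (v l)\<^sup>2)) * w\<^sup>2 = a * N"
      by (simp add: N_def w_def sum_subtractf sum_distrib_left sum_distrib_right algebra_simps)
    finally show "a \<le> l" using N by simp
  qed
  moreover have "spectrum (rcov p s t v) \<noteq> {}"
    using rcov_eigenvalue_ex[OF s0 t0, of p v] by (auto simp: spectrum_def)
  ultimately show ?thesis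
    using card_finite_spectrum(1)[OF rcov_carrier, of p s t v]
    by (auto simp: cov_class_def lambda_min_def)
qed

lemma theta_rcov:
  assumes "0 < s" "0 < t"
  shows "theta (Suc (Suc k)) (rcov (Suc k) s t v) = v k * sqrt s / sqrt (t + s * (v k)\<^sup>2)"
proof -
  have "theta (Suc (Suc k)) (rcov (Suc k) s t v) = (v k / t) / sqrt (1 / t * (1 / s + v k * v k / t))"
    by (simp add: theta_def pcorr_def precision_rcov[OF assms] rprec_def)
  also have "1 / t * (1 / s + v k * v k / t) = (t + s * (v k)\<^sup>2) / (t\<^sup>2 * s)"
    using assms by (simp add: power2_eq_square field_simps)
  also have "sqrt \<dots> = sqrt (t + s * (v k)\<^sup>2) / (t * sqrt s)"
    using assms by (simp add: real_sqrt_divide real_sqrt_mult)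
  finally show ?thesis using assms by simp
qed

section \<open>Translations of product measures\<close>

lemma PiM_density:
  assumes I: "finite I" and M: "product_sigma_finite M"
    and f [measurable]: "\<And>i. i \<in> I \<Longrightarrow> f i \<in> borel_measurable (M i)"
    and D: "product_sigma_finite (\<lambda>i. density (M i) (f i))"
  shows "(\<Pi>\<^sub>M i\<in>I. density (M i) (f i)) = density (Pi\<^sub>M I M) (\<lambda>x. \<Prod>i\<in>I. f i (x i))"
proof (rule product_sigma_finite.PiM_eqI[OF D I, symmetric])
  interpret M: product_sigma_finite M by (rule M)
  have fM [measurable]: "(\<lambda>x. \<Prod>i\<in>I. f i (x i)) \<in> borel_measurable (Pi\<^sub>M I M)"
  proof (intro borel_measurable_prod_ennreal)
    fix i assume "i \<in> I"
    then show "(\<lambda>x. f i (x i)) \<in> borel_measurable (Pi\<^sub>M I M)"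
      by (intro measurable_compose[OF measurable_component_singleton[of i I M] f])
  qed
  show "sets (density (Pi\<^sub>M I M) (\<lambda>x. \<Prod>i\<in>I. f i (x i))) = sets (\<Pi>\<^sub>M i\<in>I. density (M i) (f i))"
    by (auto intro!: sets_PiM_cong)
  fix A assume A: "\<And>i. i \<in> I \<Longrightarrow> A i \<in> sets (density (M i) (f i))"
  then have A' [measurable]: "\<And>i. i \<in> I \<Longrightarrow> A i \<in> sets (M i)" by simp
  have "emeasure (density (Pi\<^sub>M I M) (\<lambda>x. \<Prod>i\<in>I. f i (x i))) (Pi\<^sub>E I A) =
      (\<integral>\<^sup>+x. (\<Prod>i\<in>I. f i (x i)) * indicator (Pi\<^sub>E I A) x \<partial>Pi\<^sub>M I M)"
    using I by (subst emeasure_density) (auto intro!: sets_PiM_I_finite)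
  also have "\<dots> = (\<integral>\<^sup>+x. (\<Prod>i\<in>I. f i (x i) * indicator (A i) (x i)) \<partial>Pi\<^sub>M I M)"
  proof (rule nn_integral_cong)
    fix x assume x: "x \<in> space (Pi\<^sub>M I M)"
    have "(\<Prod>i\<in>I. indicator (A i) (x i) :: ennreal) = indicator (Pi\<^sub>E I A) x"
    proof (cases "x \<in> Pi\<^sub>E I A")
      case True
      then show ?thesis by (auto simp: PiE_mem)
    next
      case False
      then obtain i where "i \<in> I" "x i \<notin> A i" using x by (auto simp: space_PiM PiE_iff)
      then have "(\<Prod>i\<in>I. indicator (A i) (x i) :: ennreal) = 0"
        using I by (intro prod_zero bexI[of _ i]) auto
      then show ?thesis using False by simp
    qed
    then show "(\<Prod>i\<in>I. f i (x i)) * indicator (Pi\<^sub>E I A) x = (\<Prod>i\<in>I. f i (x i) * indicator (A i) (x i))"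
      by (simp add: prod.distrib)
  qed
  also have "\<dots> = (\<Prod>i\<in>I. \<integral>\<^sup>+y. f i y * indicator (A i) y \<partial>M i)"
    using I by (intro M.product_nn_integral_prod) auto
  also have "\<dots> = (\<Prod>i\<in>I. emeasure (density (M i) (f i)) (A i))"
    by (intro prod.cong refl) (auto simp: emeasure_density)
  finally show "emeasure (density (Pi\<^sub>M I M) (\<lambda>x. \<Prod>i\<in>I. f i (x i))) (Pi\<^sub>E I A) =
      (\<Prod>i\<in>I. emeasure (density (M i) (f i)) (A i))" .
qed

lemma product_sigma_finite_lborel: "product_sigma_finite (\<lambda>_. lborel :: real measure)"
  by (simp add: product_sigma_finite_def lborel.sigma_finite_measure_axioms)

lemma distr_PiM_lborel_translation:
  assumes I: "finite I"
  shows "distr (\<Pi>\<^sub>M i\<in>I. lborel) (\<Pi>\<^sub>M i\<in>I. lborel) (\<lambda>x. \<lambda>i\<in>I. x i + d i) = (\<Pi>\<^sub>M i\<in>I. lborel :: real measure)"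
proof (rule product_sigma_finite.PiM_eqI[OF product_sigma_finite_lborel I])
  interpret L: product_sigma_finite "\<lambda>_. lborel :: real measure" by (rule product_sigma_finite_lborel)
  fix A assume A [measurable]: "\<And>i. i \<in> I \<Longrightarrow> A i \<in> sets (lborel :: real measure)"
  have [measurable]: "(\<lambda>x. \<lambda>i\<in>I. x i + d i) \<in> (\<Pi>\<^sub>M i\<in>I. lborel :: real measure) \<rightarrow>\<^sub>M (\<Pi>\<^sub>M i\<in>I. lborel)"
    by measurable
  have B: "(\<lambda>y. y + d i) -` A i \<in> sets lborel" if "i \<in> I" for i
    using measurable_sets[of "\<lambda>y. y + d i" lborel lborel "A i"] A[OF that] by simp
  have "emeasure (distr (\<Pi>\<^sub>M i\<in>I. lborel) (\<Pi>\<^sub>M i\<in>I. lborel) (\<lambda>x. \<lambda>i\<in>I. x i + d i)) (Pi\<^sub>E I A) =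
    emeasure (\<Pi>\<^sub>M i\<in>I. lborel) ((\<lambda>x. \<lambda>i\<in>I. x i + d i) -` Pi\<^sub>E I A \<inter> space (\<Pi>\<^sub>M i\<in>I. lborel))"
    using I by (intro emeasure_distr) (auto intro!: sets_PiM_I_finite)
  also have "(\<lambda>x. \<lambda>i\<in>I. x i + d i) -` Pi\<^sub>E I A \<inter> space (\<Pi>\<^sub>M i\<in>I. lborel) = (\<Pi>\<^sub>E i\<in>I. (\<lambda>y. y + d i) -` A i)"
    by (auto simp: space_PiM PiE_iff)
  also have "emeasure (\<Pi>\<^sub>M i\<in>I. lborel) \<dots> = (\<Prod>i\<in>I. emeasure lborel ((\<lambda>y. y + d i) -` A i))"
    using I B by (rule L.emeasure_PiM)
  also have "\<dots> = (\<Prod>i\<in>I. emeasure lborel (A i))"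
  proof (intro prod.cong refl)
    fix i assume i: "i \<in> I"
    have "emeasure lborel (A i) = emeasure (distr lborel borel ((+) (d i))) (A i)"
      by (simp add: lborel_distr_plus)
    also have "\<dots> = emeasure lborel ((+) (d i) -` A i)"
      using A[OF i] by (subst emeasure_distr) auto
    also have "(+) (d i) -` A i = (\<lambda>y. y + d i) -` A i"
      by (auto simp: add.commute)
    finally show "emeasure lborel ((\<lambda>y. y + d i) -` A i) = emeasure lborel (A i)" by simp
  qed
  finally show "emeasure (distr (\<Pi>\<^sub>M i\<in>I. lborel) (\<Pi>\<^sub>M i\<in>I. lborel) (\<lambda>x. \<lambda>i\<in>I. x i + d i)) (Pi\<^sub>E I A) =
    (\<Prod>i\<in>I. emeasure lborel (A i))" .
qed simp

lemma nn_integral_PiM_lborel_translation: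
  assumes I: "finite I" and f [measurable]: "f \<in> borel_measurable (\<Pi>\<^sub>M i\<in>I. borel :: real measure)"
  shows "(\<integral>\<^sup>+x. f (\<lambda>i\<in>I. x i + d i) \<partial>(\<Pi>\<^sub>M i\<in>I. lborel)) = (\<integral>\<^sup>+x. f x \<partial>(\<Pi>\<^sub>M i\<in>I. lborel))"
proof -
  have s: "sets (\<Pi>\<^sub>M i\<in>I. lborel) = sets (\<Pi>\<^sub>M i\<in>I. borel :: real measure)"
    by (intro sets_PiM_cong) auto
  have f': "f \<in> borel_measurable (\<Pi>\<^sub>M i\<in>I. lborel)"
    using f measurable_cong_sets[OF s refl] by blast
  have "(\<integral>\<^sup>+x. f x \<partial>(\<Pi>\<^sub>M i\<in>I. lborel)) =
      (\<integral>\<^sup>+x. f x \<partial>distr (\<Pi>\<^sub>M i\<in>I. lborel) (\<Pi>\<^sub>M i\<in>I. lborel) (\<lambda>x. \<lambda>i\<in>I. x i + d i))"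
    by (simp add: distr_PiM_lborel_translation[OF I])
  also have "\<dots> = (\<integral>\<^sup>+x. f (\<lambda>i\<in>I. x i + d i) \<partial>(\<Pi>\<^sub>M i\<in>I. lborel))"
    by (rule nn_integral_distr) (use f' in measurable)
  finally show ?thesis ..
qed

section \<open>Standard Gaussian products and the cost of a translation\<close>

definition stdn :: "real measure" where
  "stdn = density lborel (\<lambda>x. ennreal (std_normal_density x))"

lemma sets_stdn [measurable_cong, simp]: "sets stdn = sets borel"
  and space_stdn [simp]: "space stdn = UNIV"
  by (simp_all add: stdn_def)

lemma prob_space_stdn: "prob_space stdn"
  unfolding stdn_def by (rule prob_space_normal_density) simp

lemma product_prob_space_stdn: "product_prob_space (\<lambda>_. stdn)"
  by (intro product_prob_spaceI prob_space_stdn)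

lemma product_sigma_finite_stdn: "product_sigma_finite (\<lambda>_. stdn)"
  by (simp add: product_sigma_finite_def prob_space_stdn prob_space_imp_sigma_finite)

lemma prob_space_PiM_stdn: "prob_space (\<Pi>\<^sub>M i\<in>I. stdn)"
  by (intro prob_space_PiM prob_space_stdn)

lemma nn_integral_normal_density:
  "0 < \<sigma> \<Longrightarrow> (\<integral>\<^sup>+x. ennreal (normal_density \<mu> \<sigma> x) \<partial>lborel) = 1"
  by (simp add: nn_integral_eq_integral)

lemma PiM_stdn_eq_density:
  assumes "finite I"
  shows "(\<Pi>\<^sub>M i\<in>I. stdn) = density (\<Pi>\<^sub>M i\<in>I. lborel) (\<lambda>x. \<Prod>i\<in>I. ennreal (std_normal_density (x i)))"
  unfolding stdn_def
  by (rule PiM_density[OF assms product_sigma_finite_lborel])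
     (use product_sigma_finite_stdn in \<open>auto simp: stdn_def\<close>)

text \<open>Translation invariance of Lebesgue measure moves the shift from the argument into the
  mean, so that the shifted and the unshifted law get densities for one common measure.\<close>

lemma nn_integral_PiM_stdn_translation:
  assumes I: "finite I" and A [measurable]: "A \<in> borel_measurable (\<Pi>\<^sub>M i\<in>I. borel :: real measure)"
  shows "(\<integral>\<^sup>+x. A (\<lambda>i\<in>I. x i + r i) \<partial>(\<Pi>\<^sub>M i\<in>I. stdn)) =
    (\<integral>\<^sup>+x. A x * (\<Prod>i\<in>I. ennreal (normal_density (r i) 1 (x i))) \<partial>(\<Pi>\<^sub>M i\<in>I. lborel))"
proof -
  have s [measurable_cong]: "sets (\<Pi>\<^sub>M i\<in>I. lborel) = sets (\<Pi>\<^sub>M i\<in>I. borel :: real measure)"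
    by (intro sets_PiM_cong) auto
  have m: "(\<lambda>x. A x * (\<Prod>i\<in>I. ennreal (normal_density (r i) 1 (x i)))) \<in> borel_measurable (\<Pi>\<^sub>M i\<in>I. borel)"
    by measurable
  have "(\<integral>\<^sup>+x. A (\<lambda>i\<in>I. x i + r i) \<partial>(\<Pi>\<^sub>M i\<in>I. stdn)) =
     (\<integral>\<^sup>+x. (\<Prod>i\<in>I. ennreal (std_normal_density (x i))) * A (\<lambda>i\<in>I. x i + r i) \<partial>(\<Pi>\<^sub>M i\<in>I. lborel))"
    unfolding PiM_stdn_eq_density[OF I] by (rule nn_integral_density) measurable
  also have "\<dots> = (\<integral>\<^sup>+x. A (\<lambda>i\<in>I. x i + r i) * (\<Prod>i\<in>I. ennreal (normal_density (r i) 1 ((\<lambda>i\<in>I. x i + r i) i))) \<partial>(\<Pi>\<^sub>M i\<in>I. lborel))"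
    by (intro nn_integral_cong) (auto simp: mult.commute normal_density_def intro!: arg_cong2[of _ _ _ _ "(*)"] prod.cong)
  also have "\<dots> = (\<integral>\<^sup>+x. A x * (\<Prod>i\<in>I. ennreal (normal_density (r i) 1 (x i))) \<partial>(\<Pi>\<^sub>M i\<in>I. lborel))"
    using nn_integral_PiM_lborel_translation[OF I m] .
  finally show ?thesis .
qed

text \<open>Takes the place of Cauchy-Schwarz between total variation and chi-square. With x a
  likelihood ratio, the bound is linear in the chi-square divergence and can later be integrated
  over the design; the price is the constant 1/8.\<close>

lemma one_minus_le_square: "1 - x \<le> 1 / 8 + 2 * (x - 1)\<^sup>2" for x :: real
proof -
  have "0 \<le> 2 * (x - 1 + 1 / 4)\<^sup>2" by simp
  then show ?thesis by (simp add: power2_eq_square algebra_simps)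
qed

text \<open>The last summand is a chi-square divergence; its value comes from
  \<open>\<phi>(x - r)\<^sup>2 / \<phi>(x) = exp (r\<^sup>2) \<phi>(x - 2 r)\<close>.\<close>

lemma nn_integral_PiM_stdn_translation_le:
  assumes I: "finite I" and A [measurable]: "A \<in> borel_measurable (\<Pi>\<^sub>M i\<in>I. borel :: real measure)"
    and A1: "\<And>x. A x \<le> 1"
  shows "(\<integral>\<^sup>+x. A x \<partial>(\<Pi>\<^sub>M i\<in>I. stdn)) \<le>
    (\<integral>\<^sup>+x. A (\<lambda>i\<in>I. x i + r i) \<partial>(\<Pi>\<^sub>M i\<in>I. stdn)) + ennreal (1 / 8 + 2 * (exp (\<Sum>i\<in>I. (r i)\<^sup>2) - 1))"
proof -
  interpret L: product_sigma_finite "\<lambda>_. lborel :: real measure" by (rule product_sigma_finite_lborel)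
  let ?L = "\<Pi>\<^sub>M i\<in>I. lborel :: real measure"
  have s [measurable_cong]: "sets ?L = sets (\<Pi>\<^sub>M i\<in>I. borel :: real measure)"
    by (intro sets_PiM_cong) auto
  define u where "u = (\<Sum>i\<in>I. (r i)\<^sup>2)"
  have u: "0 \<le> u" by (simp add: u_def sum_nonneg)
  \<comment> \<open>\<open>d c\<close> is the density of the Gaussian vector with mean
    \<open>c * r\<close>: unshifted for c = 0, shifted for c = 1, and c = 2 results from squaring
    the likelihood ratio.\<close>
  define d where "d c x = (\<Prod>i\<in>I. normal_density (c * r i) 1 (x i))" for c x
  have d_pos: "0 < d c x" for c x
    unfolding d_def by (intro prod_pos) (auto intro: normal_density_pos)
  have d_ennreal: "(\<Prod>i\<in>I. ennreal (normal_density (c * r i) 1 (x i))) = ennreal (d c x)" for c x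
    unfolding d_def by (rule prod_ennreal) simp
  have d_meas [measurable]: "d c \<in> borel_measurable (\<Pi>\<^sub>M i\<in>I. borel)" for c
    unfolding d_def by measurable
  have d_int: "(\<integral>\<^sup>+x. ennreal (d c x) \<partial>?L) = 1" for c
    unfolding d_ennreal[symmetric] using I
    by (subst L.product_nn_integral_prod) (auto simp: nn_integral_normal_density)
  define h where "h x = d 0 x * (d 1 x / d 0 x - 1)\<^sup>2" for x
  have h0: "0 \<le> h x" for x unfolding h_def using d_pos[of 0 x] by simp
  have h_meas [measurable]: "h \<in> borel_measurable (\<Pi>\<^sub>M i\<in>I. borel)"
    unfolding h_def[abs_def] by measurable
  have sq: "(d 1 x)\<^sup>2 = exp u * d 2 x * d 0 x" for x
  proof -
    have "(d 1 x)\<^sup>2 = (\<Prod>i\<in>I. (normal_density (r i) 1 (x i))\<^sup>2)"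
      by (simp add: d_def prod_power_distrib)
    also have "\<dots> = (\<Prod>i\<in>I. exp ((r i)\<^sup>2) * normal_density (2 * r i) 1 (x i) * normal_density 0 1 (x i))"
    proof (intro prod.cong refl)
      fix i
      have "exp (- (x i - r i)\<^sup>2 / 2) * exp (- (x i - r i)\<^sup>2 / 2) =
          exp ((r i)\<^sup>2) * exp (- (x i - 2 * r i)\<^sup>2 / 2) * exp (- (x i)\<^sup>2 / 2)"
        unfolding mult_exp_exp by (rule arg_cong[of _ _ exp]) (simp add: power2_eq_square field_simps)
      then show "(normal_density (r i) 1 (x i))\<^sup>2 =
          exp ((r i)\<^sup>2) * normal_density (2 * r i) 1 (x i) * normal_density 0 1 (x i)"
        by (simp add: normal_density_def power_mult_distrib power_divide power2_eq_square)
    qed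
    also have "\<dots> = exp u * d 2 x * d 0 x"
      by (simp add: prod.distrib d_def u_def exp_sum[OF I])
    finally show ?thesis .
  qed
  \<comment> \<open>The cross term - 2 \<open>d 1 x\<close> of the square stands on the left, so
    that the integration can be done in \<open>ennreal\<close>, without subtraction.\<close>
  have h_eq: "h x + 2 * d 1 x = exp u * d 2 x + d 0 x" for x
  proof -
    have "h x = (d 1 x)\<^sup>2 / d 0 x - 2 * d 1 x + d 0 x"
      unfolding h_def using d_pos[of 0 x] by (simp add: power2_eq_square field_simps)
    also have "(d 1 x)\<^sup>2 / d 0 x = exp u * d 2 x"
      unfolding sq using d_pos[of 0 x] by simp
    finally show ?thesis by simp
  qed
  have "(\<integral>\<^sup>+x. ennreal (h x) \<partial>?L) + 2 = (\<integral>\<^sup>+x. ennreal (h x) + 2 * ennreal (d 1 x) \<partial>?L)"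
    by (subst nn_integral_add) (auto simp: nn_integral_cmult d_int)
  also have "\<dots> = (\<integral>\<^sup>+x. ennreal (exp u) * ennreal (d 2 x) + ennreal (d 0 x) \<partial>?L)"
  proof (rule nn_integral_cong)
    fix x
    have "ennreal (h x) + 2 * ennreal (d 1 x) = ennreal (h x + 2 * d 1 x)"
      using h0 d_pos[of 1 x] by (simp add: ennreal_plus ennreal_mult)
    also have "\<dots> = ennreal (exp u) * ennreal (d 2 x) + ennreal (d 0 x)"
      unfolding h_eq using d_pos[of 2 x] d_pos[of 0 x] by (simp add: ennreal_plus ennreal_mult)
    finally show "ennreal (h x) + 2 * ennreal (d 1 x) = \<dots>" .
  qed
  also have "\<dots> = ennreal (exp u) + 1"
    by (subst nn_integral_add) (auto simp: nn_integral_cmult d_int)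
  also have "\<dots> = ennreal (exp u - 1) + 2"
  proof -
    have "ennreal (exp u) + 1 = ennreal (exp u - 1 + 2)"
      by (simp add: ennreal_plus[symmetric] flip: ennreal_1 del: ennreal_plus)
    also have "\<dots> = ennreal (exp u - 1) + ennreal 2"
      using u by (intro ennreal_plus) auto
    finally show ?thesis by simp
  qed
  finally have h_int: "(\<integral>\<^sup>+x. ennreal (h x) \<partial>?L) = ennreal (exp u - 1)"
    by (simp add: add.commute[of _ 2] ennreal_add_left_cancel)
  have "(\<integral>\<^sup>+x. A x \<partial>(\<Pi>\<^sub>M i\<in>I. stdn)) = (\<integral>\<^sup>+x. A x * ennreal (d 0 x) \<partial>?L)"
  proof -
    have "(\<integral>\<^sup>+x. A x \<partial>(\<Pi>\<^sub>M i\<in>I. stdn)) = (\<integral>\<^sup>+x. A (\<lambda>i\<in>I. x i + 0) \<partial>(\<Pi>\<^sub>M i\<in>I. stdn))"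
      by (intro nn_integral_cong arg_cong[of _ _ A]) (auto simp: space_PiM PiE_iff extensional_def)
    also have "\<dots> = (\<integral>\<^sup>+x. A x * ennreal (d 0 x) \<partial>?L)"
      using nn_integral_PiM_stdn_translation[OF I A, of "\<lambda>_. 0"] d_ennreal[of 0] by simp
    finally show ?thesis .
  qed
  also have "\<dots> \<le> (\<integral>\<^sup>+x. A x * ennreal (d 1 x) + (ennreal (1 / 8) * ennreal (d 0 x) + 2 * ennreal (h x)) \<partial>?L)"
  proof (rule nn_integral_mono)
    fix x
    have "d 0 x = d 1 x + d 0 x * (1 - d 1 x / d 0 x)"
      using d_pos[of 0 x] by (simp add: field_simps)
    also have "\<dots> \<le> d 1 x + d 0 x * (1 / 8 + 2 * (d 1 x / d 0 x - 1)\<^sup>2)"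
      using d_pos[of 0 x] one_minus_le_square by (intro add_left_mono mult_left_mono) auto
    also have "\<dots> = d 1 x + (1 / 8 * d 0 x + 2 * h x)"
      by (simp add: h_def algebra_simps)
    finally have "ennreal (d 0 x) \<le> ennreal (d 1 x + (1 / 8 * d 0 x + 2 * h x))"
      by (rule ennreal_leI)
    also have "\<dots> = ennreal (d 1 x) + (ennreal (1 / 8) * ennreal (d 0 x) + 2 * ennreal (h x))"
      using d_pos[of 0 x] d_pos[of 1 x] h0[of x] ennreal_mult[of "1 / 8" "d 0 x"]
      by (simp add: ennreal_plus ennreal_mult[of 2] del: ennreal_plus_if)
    finally have "A x * ennreal (d 0 x) \<le>
        A x * (ennreal (d 1 x) + (ennreal (1 / 8) * ennreal (d 0 x) + 2 * ennreal (h x)))"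
      by (rule mult_left_mono) simp
    also have "\<dots> = A x * ennreal (d 1 x) + A x * (ennreal (1 / 8) * ennreal (d 0 x) + 2 * ennreal (h x))"
      by (simp add: distrib_left)
    \<comment> \<open>\<open>A \<le> 1\<close> is spent on the remainder alone; the main term keeps
      its factor \<open>A x\<close>.\<close>
    also have "\<dots> \<le> A x * ennreal (d 1 x) + 1 * (ennreal (1 / 8) * ennreal (d 0 x) + 2 * ennreal (h x))"
      by (intro add_left_mono mult_right_mono A1) simp
    finally show "A x * ennreal (d 0 x) \<le>
        A x * ennreal (d 1 x) + (ennreal (1 / 8) * ennreal (d 0 x) + 2 * ennreal (h x))" by simp
  qed
  also have "\<dots> = (\<integral>\<^sup>+x. A x * ennreal (d 1 x) \<partial>?L) + (ennreal (1 / 8) + 2 * ennreal (exp u - 1))"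
    by (subst nn_integral_add, simp, simp, subst nn_integral_add, simp, simp)
       (simp add: nn_integral_cmult d_int h_int)
  also have "(\<integral>\<^sup>+x. A x * ennreal (d 1 x) \<partial>?L) = (\<integral>\<^sup>+x. A (\<lambda>i\<in>I. x i + r i) \<partial>(\<Pi>\<^sub>M i\<in>I. stdn))"
    using nn_integral_PiM_stdn_translation[OF I A, of r] d_ennreal[of 1] by simp
  also have "ennreal (1 / 8) + 2 * ennreal (exp u - 1) = ennreal (1 / 8 + 2 * (exp u - 1))"
    using u ennreal_plus[of "1 / 8" "2 * (exp u - 1)"] ennreal_mult[of 2 "exp u - 1"] by simp
  finally show ?thesis unfolding u_def .
qed

text \<open>The squared shift will be a random residual, of which only the mean is controlled, so
  the exponential has to become linear. Up to 1 this is exp u \<le> 1 + 2 u; beyond 1 the right-hand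
  side exceeds 1 and the claim is trivial.\<close>

lemma nn_integral_PiM_stdn_translation_le_quadratic:
  assumes I: "finite I" and A: "A \<in> borel_measurable (\<Pi>\<^sub>M i\<in>I. borel :: real measure)"
    and A1: "\<And>x. A x \<le> 1"
  shows "(\<integral>\<^sup>+x. A x \<partial>(\<Pi>\<^sub>M i\<in>I. stdn)) \<le>
    (\<integral>\<^sup>+x. A (\<lambda>i\<in>I. x i + r i) \<partial>(\<Pi>\<^sub>M i\<in>I. stdn)) + ennreal (1 / 8 + 4 * (\<Sum>i\<in>I. (r i)\<^sup>2))"
proof (cases "(\<Sum>i\<in>I. (r i)\<^sup>2) \<le> 1")
  case True
  define u where "u = (\<Sum>i\<in>I. (r i)\<^sup>2)"
  have u: "0 \<le> u" "u \<le> 1" using True by (simp_all add: u_def sum_nonneg)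
  have "exp u \<le> 1 + u + u\<^sup>2"
    using u by (intro exp_bound) auto
  also have "\<dots> \<le> 1 + 2 * u" using u by (simp add: power2_eq_square mult_left_le_one_le)
  finally have "1 / 8 + 2 * (exp u - 1) \<le> 1 / 8 + 4 * u" by simp
  then show ?thesis
    unfolding u_def
    by (intro order_trans[OF nn_integral_PiM_stdn_translation_le[OF I A A1, of r]] add_left_mono[of "ennreal _"] ennreal_leI)
next
  case False
  interpret prob_space "\<Pi>\<^sub>M i\<in>I. stdn" by (rule prob_space_PiM_stdn)
  have "(\<integral>\<^sup>+x. A x \<partial>(\<Pi>\<^sub>M i\<in>I. stdn)) \<le> (\<integral>\<^sup>+x. 1 \<partial>(\<Pi>\<^sub>M i\<in>I. stdn))"
    by (intro nn_integral_mono A1)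
  also have "\<dots> = ennreal 1" by (simp add: emeasure_space_1)
  also have "\<dots> \<le> ennreal (1 / 8 + 4 * (\<Sum>i\<in>I. (r i)\<^sup>2))"
    using False by (intro ennreal_leI) simp
  finally show ?thesis by (simp add: add_increasing)
qed

section \<open>The cost of translating the uniform law on the cube\<close>

abbreviation unit_cube :: "'i set \<Rightarrow> ('i \<Rightarrow> real) set" where
  "unit_cube J \<equiv> \<Pi>\<^sub>E j\<in>J. {0..1}"

text \<open>The only loss is the volume of the part of the cube that its translate misses, because f
  is at most 1 there.\<close>

lemma nn_integral_unit_cube_translation_le:
  assumes J: "finite J" and f [measurable]: "f \<in> borel_measurable (\<Pi>\<^sub>M j\<in>J. borel :: real measure)"
    and f1: "\<And>x. f x \<le> 1" and d: "\<And>j. j \<in> J \<Longrightarrow> \<bar>d j\<bar> \<le> 1"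
  shows "(\<integral>\<^sup>+x. f x * indicator (unit_cube J) x \<partial>(\<Pi>\<^sub>M j\<in>J. lborel)) \<le>
    (\<integral>\<^sup>+x. f (\<lambda>j\<in>J. x j + d j) * indicator (unit_cube J) x \<partial>(\<Pi>\<^sub>M j\<in>J. lborel))
      + ennreal (1 - (\<Prod>j\<in>J. 1 - \<bar>d j\<bar>))"
proof -
  interpret L: product_sigma_finite "\<lambda>_. lborel :: real measure" by (rule product_sigma_finite_lborel)
  let ?L = "\<Pi>\<^sub>M j\<in>J. lborel :: real measure"
  have s [measurable_cong]: "sets ?L = sets (\<Pi>\<^sub>M j\<in>J. borel :: real measure)"
    by (intro sets_PiM_cong) auto
  have box: "(\<Pi>\<^sub>E j\<in>J. {a j..b j}) \<in> sets (\<Pi>\<^sub>M j\<in>J. borel)" for a b :: "'a \<Rightarrow> real"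
    using J by (intro sets_PiM_I_finite) auto
  have [measurable]: "unit_cube J \<in> sets (\<Pi>\<^sub>M j\<in>J. borel)" by (rule box)
  \<comment> \<open>The intersection of the cube with its translate by d, of volume prod (1 -
    |d_j|). Moving \<open>B\<close> back by d keeps it inside the cube.\<close>
  define B where "B = (\<Pi>\<^sub>E j\<in>J. {max 0 (d j)..min 1 (1 + d j)})"
  have B [measurable]: "B \<in> sets (\<Pi>\<^sub>M j\<in>J. borel)" unfolding B_def by (rule box)
  have B_sub: "B \<subseteq> unit_cube J" unfolding B_def by (intro PiE_mono) auto
  have "emeasure ?L B = (\<Prod>j\<in>J. emeasure lborel {max 0 (d j)..min 1 (1 + d j)})"
    unfolding B_def using J by (intro L.emeasure_PiM) auto
  also have "\<dots> = (\<Prod>j\<in>J. ennreal (1 - \<bar>d j\<bar>))"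
    using d by (intro prod.cong refl, subst emeasure_lborel_Icc) (force simp: abs_le_iff intro!: arg_cong[of _ _ ennreal])+
  also have "\<dots> = ennreal (\<Prod>j\<in>J. 1 - \<bar>d j\<bar>)"
    using d by (intro prod_ennreal) auto
  finally have eB: "emeasure ?L B = ennreal (\<Prod>j\<in>J. 1 - \<bar>d j\<bar>)" .
  have eU: "emeasure ?L (unit_cube J) = 1"
    using J by (subst L.emeasure_PiM) auto
  have diff: "emeasure ?L (unit_cube J - B) = ennreal (1 - (\<Prod>j\<in>J. 1 - \<bar>d j\<bar>))"
  proof -
    have "emeasure ?L (unit_cube J - B) = emeasure ?L (unit_cube J) - emeasure ?L B"
      using B_sub eB by (intro emeasure_Diff) (simp_all add: s)
    also have "\<dots> = ennreal (1 - (\<Prod>j\<in>J. 1 - \<bar>d j\<bar>))"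
      unfolding eU eB using d by (subst ennreal_minus[symmetric]) (auto intro!: prod_nonneg)
    finally show ?thesis .
  qed
  have "(\<integral>\<^sup>+x. f x * indicator (unit_cube J) x \<partial>?L) \<le>
      (\<integral>\<^sup>+x. f x * indicator B x + indicator (unit_cube J - B) x \<partial>?L)"
    using f1 by (intro nn_integral_mono) (auto simp: indicator_def)
  also have "\<dots> = (\<integral>\<^sup>+x. f x * indicator B x \<partial>?L) + ennreal (1 - (\<Prod>j\<in>J. 1 - \<bar>d j\<bar>))"
    using diff by (subst nn_integral_add) (simp_all add: s)
  finally have 1: "(\<integral>\<^sup>+x. f x * indicator (unit_cube J) x \<partial>?L) \<le>
      (\<integral>\<^sup>+x. f x * indicator B x \<partial>?L) + ennreal (1 - (\<Prod>j\<in>J. 1 - \<bar>d j\<bar>))" .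
  have "(\<integral>\<^sup>+x. f x * indicator B x \<partial>?L) =
      (\<integral>\<^sup>+x. f (\<lambda>j\<in>J. x j + d j) * indicator B (\<lambda>j\<in>J. x j + d j) \<partial>?L)"
    by (rule nn_integral_PiM_lborel_translation[OF J, symmetric]) measurable
  also have "\<dots> \<le> (\<integral>\<^sup>+x. f (\<lambda>j\<in>J. x j + d j) * indicator (unit_cube J) x \<partial>?L)"
  proof (intro nn_integral_mono mult_left_mono)
    fix x assume x: "x \<in> space ?L"
    show "indicator B (\<lambda>j\<in>J. x j + d j) \<le> (indicator (unit_cube J) x :: ennreal)"
    proof (cases "(\<lambda>j\<in>J. x j + d j) \<in> B")
      case True
      then have "x j + d j \<in> {max 0 (d j)..min 1 (1 + d j)}" if "j \<in> J" for j
        using that by (auto simp: B_def PiE_iff)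
      then have "x j \<in> {0..1}" if "j \<in> J" for j
        using that by (force simp: max_def min_def split: if_splits)
      then have "x \<in> unit_cube J"
        using x by (auto simp: space_PiM PiE_iff)
      then show ?thesis using True by simp
    qed simp
  qed simp
  finally show ?thesis by (intro order_trans[OF 1] add_right_mono)
qed

section \<open>The residual of least squares with a Gaussian design\<close>

lemma integral_stdn:
  fixes f :: "real \<Rightarrow> real"
  assumes "has_bochner_integral lborel (\<lambda>x. std_normal_density x * f x) c" and [measurable]: "f \<in> borel_measurable borel"
  shows "integrable stdn f" "integral\<^sup>L stdn f = c"
proof -
  have "integrable stdn f \<longleftrightarrow> integrable lborel (\<lambda>x. std_normal_density x *\<^sub>R f x)"
    unfolding stdn_def by (rule integrable_density) auto
  then show "integrable stdn f" using assms(1) by (simp add: has_bochner_integral_iff)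
  have "integral\<^sup>L stdn f = (\<integral>x. std_normal_density x *\<^sub>R f x \<partial>lborel)"
    unfolding stdn_def by (rule integral_density) auto
  then show "integral\<^sup>L stdn f = c" using assms(1) by (simp add: has_bochner_integral_iff)
qed

lemma moments_stdn:
  "integrable stdn (\<lambda>x. x)" "integral\<^sup>L stdn (\<lambda>x. x) = 0"
  "integrable stdn (\<lambda>x. x * x)" "integral\<^sup>L stdn (\<lambda>x. x * x) = 1"
proof -
  have 1: "has_bochner_integral lborel (\<lambda>x. std_normal_density x * x) 0"
    using std_normal_moment_odd[of 0] by simp
  have 2: "has_bochner_integral lborel (\<lambda>x. std_normal_density x * (x * x)) 1"
    using std_normal_moment_even[of 1] by (simp add: power2_eq_square)
  show "integrable stdn (\<lambda>x. x)" "integral\<^sup>L stdn (\<lambda>x. x) = 0"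
    by (rule integral_stdn[OF 1], measurable)+
  show "integrable stdn (\<lambda>x. x * x)" "integral\<^sup>L stdn (\<lambda>x. x * x) = 1"
    by (rule integral_stdn[OF 2], measurable)+
qed

lemma second_moment_PiM_stdn:
  assumes K: "finite K" "a \<in> K" "b \<in> K"
  shows "integrable (\<Pi>\<^sub>M i\<in>K. stdn) (\<lambda>\<omega>. \<omega> a * \<omega> b)"
    and "(\<integral>\<omega>. \<omega> a * \<omega> b \<partial>(\<Pi>\<^sub>M i\<in>K. stdn)) = (if a = b then 1 else 0)"
proof -
  interpret S: product_sigma_finite "\<lambda>_. stdn" by (rule product_sigma_finite_stdn)
  interpret prob_space stdn by (rule prob_space_stdn)
  \<comment> \<open>Writing the monomial as a product over all coordinates treats a = b and a
    \<noteq> b together: a factor has mean 0 exactly when r is one of a and b but not both.\<close>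
  define f :: "'a \<Rightarrow> real \<Rightarrow> real" where
    "f r x = (if r = a then x else 1) * (if r = b then x else 1)" for r x
  have eq: "(\<lambda>\<omega>. \<omega> a * \<omega> b) = (\<lambda>\<omega>. \<Prod>r\<in>K. f r (\<omega> r))"
    using K by (simp add: f_def prod.distrib prod.delta' fun_eq_iff)
  have int: "integrable stdn (f r)" for r
    using moments_stdn by (cases "r = a"; cases "r = b") (simp_all add: f_def[abs_def])
  show "integrable (\<Pi>\<^sub>M i\<in>K. stdn) (\<lambda>\<omega>. \<omega> a * \<omega> b)"
    unfolding eq by (rule S.product_integrable_prod[OF K(1) int])
  have val: "integral\<^sup>L stdn (f r) = (if (r = a) = (r = b) then 1 else 0)" for r
    using moments_stdn prob_space by (cases "r = a"; cases "r = b") (simp_all add: f_def[abs_def])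
  show "(\<integral>\<omega>. \<omega> a * \<omega> b \<partial>(\<Pi>\<^sub>M i\<in>K. stdn)) = (if a = b then 1 else 0)"
    unfolding eq S.product_integral_prod[OF K(1) int] val
    using K by (cases "a = b") (auto intro!: prod_zero)
qed

text \<open>Fubini in coordinate \<open>a\<close>: given the others, the equation leaves a single
  value for \<omega> a, a null set. It guarantees that a Gaussian column is almost surely not
  annihilated by a nonzero projection.\<close>

lemma AE_PiM_stdn_hyperplane:
  assumes K: "finite K" "a \<in> K" and C: "C a \<noteq> (0::real)"
  shows "AE \<omega> in (\<Pi>\<^sub>M i\<in>K. stdn). (\<Sum>r\<in>K. C r * \<omega> r) \<noteq> 0"
proof -
  interpret S: product_sigma_finite "\<lambda>_. stdn" by (rule product_sigma_finite_stdn)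
  define K' where "K' = K - {a}"
  have K': "finite K'" "a \<notin> K'" "K = insert a K'" using K by (auto simp: K'_def)
  define N where "N = {\<omega> \<in> space (\<Pi>\<^sub>M i\<in>K. stdn). (\<Sum>r\<in>K. C r * \<omega> r) = 0}"
  have N [measurable]: "N \<in> sets (\<Pi>\<^sub>M i\<in>K. stdn)"
    unfolding N_def by measurable
  have "emeasure (\<Pi>\<^sub>M i\<in>K. stdn) N = (\<integral>\<^sup>+x. (\<integral>\<^sup>+y. indicator N (x(a := y)) \<partial>stdn) \<partial>(\<Pi>\<^sub>M i\<in>K'. stdn))"
    using N unfolding K'(3) by (subst S.product_nn_integral_insert[OF K'(1,2), symmetric]) auto
  also have "\<dots> \<le> (\<integral>\<^sup>+x. 0 \<partial>(\<Pi>\<^sub>M i\<in>K'. stdn))"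
  proof (rule nn_integral_mono)
    fix x :: "'a \<Rightarrow> real"
    define y0 where "y0 = - (\<Sum>r\<in>K'. C r * x r) / C a"
    have "(\<integral>\<^sup>+y. indicator N (x(a := y)) \<partial>stdn) \<le> (\<integral>\<^sup>+y. indicator {y0} y \<partial>stdn)"
    proof (rule nn_integral_mono)
      fix y
      have "y = y0" if "x(a := y) \<in> N"
      proof -
        have "(\<Sum>r\<in>K'. C r * (x(a := y)) r) = (\<Sum>r\<in>K'. C r * x r)"
          using K'(2) by (intro sum.cong) auto
        then have "C a * y + (\<Sum>r\<in>K'. C r * x r) = 0"
          using that K' by (simp add: N_def)
        then show ?thesis using C by (simp add: y0_def field_simps add_eq_0_iff)
      qed
      then show "indicator N (x(a := y)) \<le> (indicator {y0} y :: ennreal)"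
        by (auto simp: indicator_def)
    qed
    also have "\<dots> = emeasure stdn {y0}" by simp
    also have "\<dots> = 0"
      unfolding stdn_def by (subst emeasure_density) (auto intro!: nn_integral_zero' AE_I[of _ _ "{y0}"] simp: indicator_def)
    finally show "(\<integral>\<^sup>+y. indicator N (x(a := y)) \<partial>stdn) \<le> 0" .
  qed
  finally have "N \<in> null_sets (\<Pi>\<^sub>M i\<in>K. stdn)" using N by auto
  then show ?thesis
    by (rule AE_I') (auto simp: N_def)
qed

section \<open>Orthogonal projections and residual sums of squares\<close>

definition quad :: "nat \<Rightarrow> (nat \<Rightarrow> nat \<Rightarrow> real) \<Rightarrow> (nat \<Rightarrow> real) \<Rightarrow> real" where
  "quad n P y = (\<Sum>i<n. \<Sum>l<n. y i * P i l * y l)"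

text \<open>Projections are plain index functions, so no dimension has to be carried along. For them
  \<open>quad n P y\<close> is |P y|^2, the residual sum of squares once the regressors in the
  kernel of P have been removed; the trace of P counts the remaining degrees of freedom. Symmetry is
  asked for all indices, which lets it be used without bounds.\<close>

definition orth_proj :: "nat \<Rightarrow> (nat \<Rightarrow> nat \<Rightarrow> real) \<Rightarrow> bool" where
  "orth_proj n P \<longleftrightarrow> (\<forall>i l. P i l = P l i) \<and> (\<forall>i<n. \<forall>l<n. (\<Sum>k<n. P i k * P k l) = P i l)"

lemma orth_proj_sym: "orth_proj n P \<Longrightarrow> P i l = P l i"
  and orth_proj_idem: "orth_proj n P \<Longrightarrow> i < n \<Longrightarrow> l < n \<Longrightarrow> (\<Sum>k<n. P i k * P k l) = P i l"
  unfolding orth_proj_def by blast+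

lemma orth_proj_mult_idem:
  assumes P: "orth_proj n P" and i: "i < n"
  shows "(\<Sum>k<n. P i k * (\<Sum>l<n. P k l * z l)) = (\<Sum>l<n. P i l * z l)"
proof -
  have "(\<Sum>k<n. P i k * (\<Sum>l<n. P k l * z l)) = (\<Sum>l<n. \<Sum>k<n. P i k * P k l * z l)"
    unfolding sum_distrib_left by (subst sum.swap) (simp add: mult.assoc)
  also have "\<dots> = (\<Sum>l<n. P i l * z l)"
    using i by (intro sum.cong refl) (simp add: sum_distrib_right[symmetric] orth_proj_idem[OF P])
  finally show ?thesis .
qed

lemma quad_orth_proj:
  assumes P: "orth_proj n P"
  shows "quad n P z = (\<Sum>i<n. (\<Sum>l<n. P i l * z l)\<^sup>2)"
proof -
  have "(\<Sum>i<n. (\<Sum>l<n. P i l * z l)\<^sup>2) = (\<Sum>i<n. \<Sum>l<n. z l * (P l i * (\<Sum>k<n. P i k * z k)))"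
  proof (intro sum.cong refl)
    fix i
    have "(\<Sum>l<n. P i l * z l)\<^sup>2 = (\<Sum>l<n. P i l * z l * (\<Sum>k<n. P i k * z k))"
      unfolding power2_eq_square sum_distrib_right ..
    also have "\<dots> = (\<Sum>l<n. z l * (P l i * (\<Sum>k<n. P i k * z k)))"
    proof (intro sum.cong refl)
      fix l show "P i l * z l * (\<Sum>k<n. P i k * z k) = z l * (P l i * (\<Sum>k<n. P i k * z k))"
        using orth_proj_sym[OF P, of i l] by simp
    qed
    finally show "(\<Sum>l<n. P i l * z l)\<^sup>2 = \<dots>" .
  qed
  also have "\<dots> = (\<Sum>l<n. z l * (\<Sum>i<n. P l i * (\<Sum>k<n. P i k * z k)))"
    by (subst sum.swap) (simp add: sum_distrib_left)
  also have "\<dots> = (\<Sum>l<n. z l * (\<Sum>k<n. P l k * z k))"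
    by (intro sum.cong refl) (simp add: orth_proj_mult_idem[OF P])
  also have "\<dots> = quad n P z"
    by (simp add: quad_def sum_distrib_left mult.assoc)
  finally show ?thesis ..
qed

lemma quad_diff:
  assumes "\<And>i l. P i l = P l i"
  shows "quad n P (\<lambda>i. y i - c * z i) =
    quad n P y - 2 * c * (\<Sum>i<n. (\<Sum>l<n. P i l * z l) * y i) + c\<^sup>2 * quad n P z"
proof -
  have "quad n P (\<lambda>i. y i - c * z i) = (\<Sum>i<n. \<Sum>l<n. y i * P i l * y l - c * (y i * P i l * z l)
      - c * (z i * P i l * y l) + c\<^sup>2 * (z i * P i l * z l))"
    unfolding quad_def by (intro sum.cong refl) (simp add: power2_eq_square algebra_simps)
  also have "\<dots> = quad n P y - c * (\<Sum>i<n. \<Sum>l<n. y i * P i l * z l)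
      - c * (\<Sum>i<n. \<Sum>l<n. z i * P i l * y l) + c\<^sup>2 * quad n P z"
    by (simp add: quad_def sum.distrib sum_subtractf sum_distrib_left)
  also have "(\<Sum>i<n. \<Sum>l<n. z i * P i l * y l) = (\<Sum>i<n. \<Sum>l<n. y i * P i l * z l)"
    by (subst sum.swap) (simp add: assms mult_ac)
  also have "\<dots> = (\<Sum>i<n. (\<Sum>l<n. P i l * z l) * y i)"
    by (simp add: sum_distrib_left sum_distrib_right mult_ac)
  finally show ?thesis by simp
qed

text \<open>One step of Gram--Schmidt; the last equation says that projecting off \<open>P z\<close> amounts to
  subtracting the optimal multiple of \<open>z\<close>.\<close>

lemma orth_proj_remove:
  fixes z y :: "nat \<Rightarrow> real"
  assumes P: "orth_proj n P"
  defines "g \<equiv> \<lambda>i. \<Sum>l<n. P i l * z l"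
  assumes q: "quad n P z \<noteq> 0"
  defines "P' \<equiv> \<lambda>i l. P i l - g i * g l / quad n P z"
  shows "orth_proj n P'"
    and "(\<Sum>i<n. P' i i) = (\<Sum>i<n. P i i) - 1"
    and "quad n P' y = quad n P (\<lambda>i. y i - (\<Sum>i<n. g i * y i) / quad n P z * z i)"
proof -
  define c where "c = quad n P z"
  have c: "c \<noteq> 0" using q by (simp add: c_def)
  note sym = orth_proj_sym[OF P]
  have gg: "(\<Sum>i<n. g i * g i) = c"
    unfolding c_def quad_orth_proj[OF P] by (simp add: g_def power2_eq_square)
  have Pg: "(\<Sum>k<n. P i k * g k) = g i" if "i < n" for i
    unfolding g_def by (rule orth_proj_mult_idem[OF P that])
  show "orth_proj n P'"
    unfolding orth_proj_def
  proof (intro conjI allI impI)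
    show "P' i l = P' l i" for i l by (simp add: P'_def sym[of i l] mult.commute)
    fix i l assume il: "i < n" "l < n"
    have "(\<Sum>k<n. P' i k * P' k l) = (\<Sum>k<n. P i k * P k l - (P i k * g k) * (g l / c)
        - (P l k * g k) * (g i / c) + (g k * g k) * (g i * g l / c\<^sup>2))"
    proof (intro sum.cong refl)
      fix k
      show "P' i k * P' k l = P i k * P k l - (P i k * g k) * (g l / c)
        - (P l k * g k) * (g i / c) + (g k * g k) * (g i * g l / c\<^sup>2)"
        unfolding P'_def c_def[symmetric] sym[of l k] using c
        by (simp add: power2_eq_square field_simps)
    qed
    also have "\<dots> = P i l - g i * (g l / c) - g l * (g i / c) + c * (g i * g l / c\<^sup>2)"
      using il
      by (simp add: orth_proj_idem[OF P] sum.distrib sum_subtractf sum_distrib_right[symmetric] Pg gg sum_divide_distrib[symmetric])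
    also have "\<dots> = P' i l"
      unfolding P'_def c_def[symmetric] using c by (simp add: power2_eq_square field_simps)
    finally show "(\<Sum>k<n. P' i k * P' k l) = P' i l" .
  qed
  show "(\<Sum>i<n. P' i i) = (\<Sum>i<n. P i i) - 1"
    unfolding P'_def c_def[symmetric] using c gg
    by (simp add: sum_subtractf sum_divide_distrib[symmetric])
  have P'c: "P' i l = P i l - g i * g l / c" for i l by (simp add: P'_def c_def)
  define b where "b = (\<Sum>i<n. g i * y i)"
  have "quad n P' y = quad n P y - (\<Sum>i<n. \<Sum>l<n. (g i * y i) * (g l * y l) / c)"
    unfolding quad_def P'c sum_subtractf[symmetric]
    using c by (intro sum.cong refl) (simp add: field_simps)
  also have "(\<Sum>i<n. \<Sum>l<n. (g i * y i) * (g l * y l) / c) = b * b / c"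
    unfolding b_def sum_product by (simp add: sum_divide_distrib)
  \<comment> \<open>Completing the square: b / c minimises the quadratic polynomial of
    \<open>quad_diff\<close> in the multiple of z that is subtracted.\<close>
  also have "quad n P y - b * b / c = quad n P y - 2 * (b / c) * b + (b / c)\<^sup>2 * c"
    using c by (simp add: power2_eq_square field_simps)
  also have "\<dots> = quad n P (\<lambda>i. y i - b / c * z i)"
    unfolding quad_diff[OF sym] by (simp add: c_def b_def g_def)
  finally show "quad n P' y = quad n P (\<lambda>i. y i - (\<Sum>i<n. g i * y i) / quad n P z * z i)"
    unfolding b_def c_def .
qed

text \<open>The least-squares coefficients never have to be chosen measurably in \<open>\<omega>\<close>, because \<open>h\<close> is a
  measurable minorant of the residual for all \<open>w\<close> at once.\<close>

lemma nn_integral_residual_le: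
  assumes "finite J" "c \<notin> J" "orth_proj n P" "real (card J) \<le> (\<Sum>i<n. P i i)"
    and "h \<in> borel_measurable (\<Pi>\<^sub>M _\<in>{..<n} \<times> insert c J. stdn)"
    and "\<And>\<omega> w. \<omega> \<in> space (\<Pi>\<^sub>M _\<in>{..<n} \<times> insert c J. stdn) \<Longrightarrow>
      h \<omega> \<le> ennreal (quad n P (\<lambda>i. \<omega> (i, c) - (\<Sum>j\<in>J. w j * \<omega> (i, j))))"
  shows "(\<integral>\<^sup>+\<omega>. h \<omega> \<partial>(\<Pi>\<^sub>M _\<in>{..<n} \<times> insert c J. stdn)) \<le> ennreal ((\<Sum>i<n. P i i) - card J)"
  using assms
proof (induction J arbitrary: P h rule: finite_induct)
  \<comment> \<open>With no regressor left, the mean of y' P y for standard normal y is the trace of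
    P.\<close>
  case empty
  let ?S = "\<Pi>\<^sub>M _\<in>{..<n} \<times> {c}. stdn"
  note [measurable] = empty.prems(4)
  have eq: "quad n P (\<lambda>i. \<omega> (i, c)) = (\<Sum>i<n. \<Sum>l<n. P i l * (\<omega> (i, c) * \<omega> (l, c)))" for \<omega>
    by (simp add: quad_def mult_ac)
  have int2: "integrable ?S (\<lambda>\<omega>. P i l * (\<omega> (i, c) * \<omega> (l, c)))"
    and val2: "(\<integral>\<omega>. P i l * (\<omega> (i, c) * \<omega> (l, c)) \<partial>?S) = P i l * (if i = l then 1 else 0)"
    if "i \<in> {..<n}" "l \<in> {..<n}" for i l
    using that second_moment_PiM_stdn[of "{..<n} \<times> {c}" "(i, c)" "(l, c)"] by auto
  have int: "integrable ?S (\<lambda>\<omega>. quad n P (\<lambda>i. \<omega> (i, c)))"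
    unfolding eq by (intro Bochner_Integration.integrable_sum int2)
  have "(\<integral>\<omega>. quad n P (\<lambda>i. \<omega> (i, c)) \<partial>?S) = (\<Sum>i<n. \<integral>\<omega>. (\<Sum>l<n. P i l * (\<omega> (i, c) * \<omega> (l, c))) \<partial>?S)"
    unfolding eq by (intro Bochner_Integration.integral_sum Bochner_Integration.integrable_sum int2)
  also have "\<dots> = (\<Sum>i<n. \<Sum>l<n. \<integral>\<omega>. P i l * (\<omega> (i, c) * \<omega> (l, c)) \<partial>?S)"
    by (intro sum.cong refl Bochner_Integration.integral_sum int2)
  also have "\<dots> = (\<Sum>i<n. \<Sum>l<n. P i l * (if i = l then 1 else 0))"
    by (intro sum.cong refl val2)
  also have "\<dots> = (\<Sum>i<n. P i i)"
    by (intro sum.cong refl) (simp add: if_distrib[of "\<lambda>x. _ * x"] sum.delta cong: if_cong)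
  finally have val: "(\<integral>\<omega>. quad n P (\<lambda>i. \<omega> (i, c)) \<partial>?S) = (\<Sum>i<n. P i i)" .
  have "(\<integral>\<^sup>+\<omega>. h \<omega> \<partial>?S) \<le> (\<integral>\<^sup>+\<omega>. ennreal (quad n P (\<lambda>i. \<omega> (i, c))) \<partial>?S)"
    using empty.prems(5) by (intro nn_integral_mono) simp
  also have "\<dots> = ennreal (\<Sum>i<n. P i i)"
    using int val quad_orth_proj[OF empty.prems(2)]
    by (subst nn_integral_eq_integral) (auto simp: sum_nonneg)
  finally show ?case by simp
next
  case (insert j J)
  interpret S: product_sigma_finite "\<lambda>_. stdn" by (rule product_sigma_finite_stdn)
  let ?A = "{..<n} \<times> {j}" and ?B = "{..<n} \<times> insert c J"
  let ?SA = "\<Pi>\<^sub>M _\<in>?A. stdn" and ?SB = "\<Pi>\<^sub>M _\<in>?B. stdn"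
  have AB: "?A \<inter> ?B = {}" "finite ?A" "finite ?B" "{..<n} \<times> insert c (insert j J) = ?A \<union> ?B"
    using insert.hyps insert.prems(1) by auto
  have h [measurable]: "h \<in> borel_measurable (\<Pi>\<^sub>M _\<in>?A \<union> ?B. stdn)"
    using insert.prems(4) unfolding AB(4) .
  have P: "orth_proj n P" by (rule insert.prems(2))
  let ?t = "\<Sum>i<n. P i i"
  have card: "real (card J) + 1 \<le> ?t" using insert.prems(3) insert.hyps by simp
  have "?t \<noteq> 0" using card by linarith
  \<comment> \<open>A projection with positive trace has a nonzero diagonal entry; row
    \<open>i0\<close> then defines a proper hyperplane outside of which the projected column does
    not vanish.\<close>
  then obtain i0 where i0: "i0 < n" "P i0 i0 \<noteq> 0"
    by (metis (no_types, lifting) lessThan_iff sum.neutral)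
  interpret PA: prob_space ?SA by (rule prob_space_PiM_stdn)
  have "AE z in ?SA. (\<Sum>r\<in>?A. P i0 (fst r) * z r) \<noteq> 0"
    using i0 by (intro AE_PiM_stdn_hyperplane[of _ "(i0, j)"]) auto
  then have AE: "AE z in ?SA. quad n P (\<lambda>i. z (i, j)) \<noteq> 0"
  proof eventually_elim
    case (elim z)
    have "(\<Sum>r\<in>?A. P i0 (fst r) * z r) = (\<Sum>l<n. P i0 l * z (l, j))"
      by (rule sum.reindex_bij_witness[of _ "\<lambda>l. (l, j)" fst]) auto
    then have "0 < (\<Sum>l<n. P i0 l * z (l, j))\<^sup>2" using elim by simp
    also have "\<dots> \<le> quad n P (\<lambda>i. z (i, j))"
      unfolding quad_orth_proj[OF P] using i0 by (intro member_le_sum) auto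
    finally show ?case by simp
  qed
  have "(\<integral>\<^sup>+\<omega>. h \<omega> \<partial>(\<Pi>\<^sub>M _\<in>{..<n} \<times> insert c (insert j J). stdn)) =
      (\<integral>\<^sup>+z. (\<integral>\<^sup>+\<omega>. h (merge ?A ?B (z, \<omega>)) \<partial>?SB) \<partial>?SA)"
    unfolding AB(4) by (rule S.product_nn_integral_fold[OF AB(1-3) h])
  also have "\<dots> \<le> (\<integral>\<^sup>+z. ennreal (?t - card (insert j J)) \<partial>?SA)"
  proof (rule nn_integral_mono_AE)
    show "AE z in ?SA. (\<integral>\<^sup>+\<omega>. h (merge ?A ?B (z, \<omega>)) \<partial>?SB) \<le> ennreal (?t - card (insert j J))"
      using AE AE_space
    proof eventually_elim
      case (elim z)
      note z = elim(2)
      define g where "g i = (\<Sum>l<n. P i l * z (l, j))" for i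
      define P' where "P' i l = P i l - g i * g l / quad n P (\<lambda>i. z (i, j))" for i l
      note P' = orth_proj_remove[OF P elim(1), folded g_def P'_def]
      have "(\<integral>\<^sup>+\<omega>. h (merge ?A ?B (z, \<omega>)) \<partial>?SB) \<le> ennreal ((\<Sum>i<n. P' i i) - card J)"
      proof (rule insert.IH[where P = P'])
        show "c \<notin> J" using insert.prems by simp
        show "orth_proj n P'" by (rule P'(1))
        show "real (card J) \<le> (\<Sum>i<n. P' i i)" using card by (simp add: P'(2))
        show "(\<lambda>\<omega>. h (merge ?A ?B (z, \<omega>))) \<in> borel_measurable ?SB"
          using z by measurable
        fix \<omega> w assume \<omega>: "\<omega> \<in> space ?SB"
        define y where "y i = \<omega> (i, c) - (\<Sum>j\<in>J. w j * \<omega> (i, j))" for i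
        \<comment> \<open>The optimal coefficient of column j. It depends on \<omega>, which is
          harmless: the hypothesis on \<open>h\<close> holds at each \<omega> for every coefficient
          vector. After this choice the bound has the form required by the induction hypothesis with
          P', whose trace is smaller by 1.\<close>
        define b where "b = (\<Sum>i<n. g i * y i) / quad n P (\<lambda>i. z (i, j))"
        let ?m = "merge ?A ?B (z, \<omega>)"
        have m: "?m \<in> space (\<Pi>\<^sub>M _\<in>{..<n} \<times> insert c (insert j J). stdn)"
          unfolding AB(4) by (simp add: space_PiM PiE_iff)
        have "h ?m \<le> ennreal (quad n P (\<lambda>i. ?m (i, c) - (\<Sum>l\<in>insert j J. (w(j := b)) l * ?m (i, l))))"
          by (rule insert.prems(5)[OF m])
        also have "quad n P (\<lambda>i. ?m (i, c) - (\<Sum>l\<in>insert j J. (w(j := b)) l * ?m (i, l))) =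
          quad n P (\<lambda>i. y i - b * z (i, j))"
        proof -
          have "?m (i, c) - (\<Sum>l\<in>insert j J. (w(j := b)) l * ?m (i, l)) = y i - b * z (i, j)" if i: "i < n" for i
          proof -
            have "(\<Sum>l\<in>J. (w(j := b)) l * ?m (i, l)) = (\<Sum>l\<in>J. w l * \<omega> (i, l))"
              using insert.hyps i by (intro sum.cong refl) (auto simp: merge_def)
            then show ?thesis
              using insert.hyps insert.prems(1) i by (auto simp: merge_def y_def)
          qed
          then show ?thesis unfolding quad_def by (intro sum.cong refl) auto
        qed
        also have "\<dots> = quad n P' y" unfolding b_def P'(3) ..
        finally show "h ?m \<le> ennreal (quad n P' (\<lambda>i. \<omega> (i, c) - (\<Sum>j\<in>J. w j * \<omega> (i, j))))"
          unfolding y_def .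
      qed
      then show ?case using insert.hyps by (simp add: P'(2) algebra_simps)
    qed
  qed
  also have "\<dots> = ennreal (?t - card (insert j J))"
    by (simp add: PA.emeasure_space_1)
  finally show ?case .
qed

text \<open>The induction starts from the identity, of trace n, and each regressor costs one degree
  of freedom.\<close>

corollary nn_integral_least_squares_le:
  assumes "finite J" "c \<notin> J" "card J \<le> n"
    and "h \<in> borel_measurable (\<Pi>\<^sub>M _\<in>{..<n} \<times> insert c J. stdn)"
    and h: "\<And>\<omega> w. \<omega> \<in> space (\<Pi>\<^sub>M _\<in>{..<n} \<times> insert c J. stdn) \<Longrightarrow>
      h \<omega> \<le> ennreal (\<Sum>i<n. (\<omega> (i, c) - (\<Sum>j\<in>J. w j * \<omega> (i, j)))\<^sup>2)"
  shows "(\<integral>\<^sup>+\<omega>. h \<omega> \<partial>(\<Pi>\<^sub>M _\<in>{..<n} \<times> insert c J. stdn)) \<le> ennreal (real n - card J)"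
proof -
  define P :: "nat \<Rightarrow> nat \<Rightarrow> real" where "P i l = (if i = l then 1 else 0)" for i l
  have "quad n P y = (\<Sum>i<n. (y i)\<^sup>2)" for y
    unfolding quad_def P_def
    by (intro sum.cong refl) (simp add: if_distrib[of "\<lambda>x. x * _"] if_distrib[of "\<lambda>x. _ * x"] power2_eq_square cong: if_cong)
  moreover have "orth_proj n P"
    unfolding orth_proj_def P_def by (simp add: if_distrib[of "\<lambda>x. x * _"] cong: if_cong)
  moreover have "(\<Sum>i<n. P i i) = real n" by (simp add: P_def)
  ultimately show ?thesis
    using nn_integral_residual_le[of J c n P h] assms by simp
qed

section \<open>The sample as a function of independent standard normal variables\<close>

text \<open>An explicit triangular square root of \<open>rcov p s t v\<close>, applied to standard
  normal coordinates. It puts the laws for all slopes and variances on one probability space, where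
  they can be compared pathwise.\<close>

definition mix_row :: "nat \<Rightarrow> real \<Rightarrow> real \<Rightarrow> (nat \<Rightarrow> real) \<Rightarrow> (nat \<Rightarrow> real) \<Rightarrow> nat \<Rightarrow> real" where
  "mix_row p s t v e = (\<lambda>j\<in>{..<Suc p}.
     if j < p then sqrt s * e j else (\<Sum>l<p. v l * (sqrt s * e l)) + sqrt t * e p)"

lemma mix_row_measurable [measurable]:
  "mix_row p s t v \<in> (\<Pi>\<^sub>M j\<in>{..<Suc p}. borel) \<rightarrow>\<^sub>M (\<Pi>\<^sub>M j\<in>{..<Suc p}. borel)"
  unfolding mix_row_def[abs_def]
proof (rule measurable_restrict)
  fix j assume j: "j \<in> {..<Suc p}"
  show "(\<lambda>e. if j < p then sqrt s * e j else (\<Sum>l<p. v l * (sqrt s * e l)) + sqrt t * e p)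
      \<in> borel_measurable (\<Pi>\<^sub>M j\<in>{..<Suc p}. borel)"
    using j by (cases "j < p") (auto intro!: borel_measurable_add borel_measurable_sum borel_measurable_times)
qed

lemma sets_PiM_stdn [measurable_cong]: "sets (\<Pi>\<^sub>M i\<in>I. stdn) = sets (\<Pi>\<^sub>M i\<in>I. borel)"
  by (intro sets_PiM_cong) auto

lemma mix_row_measurable_stdn:
  "mix_row p s t v \<in> (\<Pi>\<^sub>M j\<in>{..<Suc p}. stdn) \<rightarrow>\<^sub>M (\<Pi>\<^sub>M j\<in>{..<Suc p}. borel)"
  using mix_row_measurable measurable_cong_sets[OF sets_PiM_stdn refl] by blast

lemma sets_PiM_lborel: "sets (\<Pi>\<^sub>M i\<in>I. lborel) = sets (\<Pi>\<^sub>M i\<in>I. borel)"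
  by (intro sets_PiM_cong) auto

lemma distr_stdn_scale:
  assumes "0 < s"
  shows "distr stdn lborel ((*) (sqrt s)) = density lborel (\<lambda>x. ennreal (normal_density 0 (sqrt s) x))"
proof -
  interpret prob_space stdn by (rule prob_space_stdn)
  have "distributed stdn lborel (\<lambda>x. x) (\<lambda>x. ennreal (normal_density 0 1 x))"
    unfolding distributed_def stdn_def by (auto simp: distr_id2)
  from normal_density_affine[OF this, of "sqrt s" 0]
  have "distributed stdn lborel (\<lambda>x. sqrt s * x) (\<lambda>x. ennreal (normal_density 0 (sqrt s) x))"
    using assms by simp
  then show ?thesis by (simp add: distributed_def)
qed

lemma nn_integral_PiM_normal:
  assumes s: "0 < s" and J: "finite J" and f [measurable]: "f \<in> borel_measurable (\<Pi>\<^sub>M j\<in>J. borel)"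
  shows "(\<integral>\<^sup>+x. ennreal (\<Prod>j\<in>J. normal_density 0 (sqrt s) (x j)) * f x \<partial>(\<Pi>\<^sub>M j\<in>J. lborel)) =
    (\<integral>\<^sup>+x. f (\<lambda>j\<in>J. sqrt s * x j) \<partial>(\<Pi>\<^sub>M j\<in>J. stdn))"
proof -
  note [measurable_cong] = sets_PiM_lborel
  let ?N = "density lborel (\<lambda>x. ennreal (normal_density 0 (sqrt s) x))"
  have P: "prob_space ?N" using s by (intro prob_space_normal_density) simp
  have "(\<integral>\<^sup>+x. ennreal (\<Prod>j\<in>J. normal_density 0 (sqrt s) (x j)) * f x \<partial>(\<Pi>\<^sub>M j\<in>J. lborel)) =
     (\<integral>\<^sup>+x. f x \<partial>density (\<Pi>\<^sub>M j\<in>J. lborel) (\<lambda>x. \<Prod>j\<in>J. ennreal (normal_density 0 (sqrt s) (x j))))"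
    by (subst nn_integral_density) (auto simp: prod_ennreal)
  also have "density (\<Pi>\<^sub>M j\<in>J. lborel) (\<lambda>x. \<Prod>j\<in>J. ennreal (normal_density 0 (sqrt s) (x j))) = (\<Pi>\<^sub>M j\<in>J. ?N)"
    by (rule PiM_density[OF J product_sigma_finite_lborel, symmetric])
       (auto simp: product_sigma_finite_def intro!: prob_space_imp_sigma_finite P)
  also have "(\<Pi>\<^sub>M j\<in>J. ?N) = distr (\<Pi>\<^sub>M j\<in>J. stdn) (\<Pi>\<^sub>M j\<in>J. ?N) (compose J ((*) (sqrt s)))"
  proof -
    have "distr stdn ?N ((*) (sqrt s)) = ?N"
      unfolding distr_stdn_scale[OF s, symmetric] by (intro distr_cong) auto
    then have "(\<Pi>\<^sub>M j\<in>J. ?N) = (\<Pi>\<^sub>M j\<in>J. distr stdn ?N ((*) (sqrt s)))" by simp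
    also have "\<dots> = distr (\<Pi>\<^sub>M j\<in>J. stdn) (\<Pi>\<^sub>M j\<in>J. ?N) (compose J ((*) (sqrt s)))"
      by (rule distr_PiM_finite_prob_space[symmetric, OF J])
         (auto intro!: product_prob_spaceI P prob_space_stdn)
    finally show ?thesis .
  qed
  also have "(\<integral>\<^sup>+x. f x \<partial>distr (\<Pi>\<^sub>M j\<in>J. stdn) (\<Pi>\<^sub>M j\<in>J. ?N) (compose J ((*) (sqrt s)))) =
      (\<integral>\<^sup>+x. f (compose J ((*) (sqrt s)) x) \<partial>(\<Pi>\<^sub>M j\<in>J. stdn))"
  proof (rule nn_integral_distr)
    show "compose J ((*) (sqrt s)) \<in> (\<Pi>\<^sub>M j\<in>J. stdn) \<rightarrow>\<^sub>M (\<Pi>\<^sub>M j\<in>J. ?N)"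
      unfolding compose_def by (intro measurable_restrict) auto
    have "sets (\<Pi>\<^sub>M j\<in>J. ?N) = sets (\<Pi>\<^sub>M j\<in>J. borel)" by (intro sets_PiM_cong) auto
    then have "f \<in> borel_measurable (\<Pi>\<^sub>M j\<in>J. ?N)" using f measurable_cong_sets by blast
    then show "f \<in> borel_measurable (distr (\<Pi>\<^sub>M j\<in>J. stdn) (\<Pi>\<^sub>M j\<in>J. ?N) (compose J ((*) (sqrt s))))"
      by simp
  qed
  finally show ?thesis by (simp add: compose_def)
qed

text \<open>The factored density allows the response to be integrated first, by the substitution y =
  m x + sqrt t e; rescaling the regressors does the rest. This way no general change of variables
  for linear maps is involved.\<close>

lemma mvn_rcov:
  assumes s: "0 < s" and t: "0 < t"
  shows "mvn (Suc p) (rcov p s t v) =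
    distr (\<Pi>\<^sub>M j\<in>{..<Suc p}. stdn) (\<Pi>\<^sub>M j\<in>{..<Suc p}. borel) (mix_row p s t v)"
proof (rule measure_eqI)
  note [measurable_cong] = sets_PiM_lborel
  interpret L: product_sigma_finite "\<lambda>_. lborel :: real measure" by (rule product_sigma_finite_lborel)
  interpret S: product_sigma_finite "\<lambda>_. stdn" by (rule product_sigma_finite_stdn)
  show "sets (mvn (Suc p) (rcov p s t v)) =
    sets (distr (\<Pi>\<^sub>M j\<in>{..<Suc p}. stdn) (\<Pi>\<^sub>M j\<in>{..<Suc p}. borel) (mix_row p s t v))"
    by (simp add: mvn_def sets_PiM_lborel)
  fix A assume "A \<in> sets (mvn (Suc p) (rcov p s t v))"
  then have A [measurable]: "A \<in> sets (\<Pi>\<^sub>M j\<in>insert p {..<p}. borel)"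
    by (simp add: mvn_def sets_PiM_lborel lessThan_Suc)
  define m where "m x = (\<Sum>j<p. v j * x j)" for x :: "nat \<Rightarrow> real"
  have m [measurable]: "m \<in> borel_measurable (\<Pi>\<^sub>M j\<in>{..<p}. borel)"
    unfolding m_def by measurable
  have m_ins [measurable]: "m \<in> borel_measurable (\<Pi>\<^sub>M j\<in>insert p {..<p}. borel)"
    unfolding m_def by measurable
  define dens where "dens x = ennreal (\<Prod>j<p. normal_density 0 (sqrt s) (x j)) * ennreal (normal_density (m x) (sqrt t) (x p))" for x
  have [measurable]: "dens \<in> borel_measurable (\<Pi>\<^sub>M j\<in>insert p {..<p}. borel)"
    unfolding dens_def normal_density_def by measurable
  have dens_eq: "dens x = ennreal ((\<Prod>j<p. normal_density 0 (sqrt s) (x j)) * normal_density (m x) (sqrt t) (x p))" for x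
    by (simp add: dens_def ennreal_mult prod_nonneg)
  \<comment> \<open>The conditional probability of \<open>A\<close> given the regressors x.\<close>
  define G where "G x = (\<integral>\<^sup>+e. indicator A (x(p := m x + sqrt t * e)) \<partial>stdn)" for x
  have upd: "(\<lambda>(x, y). x(p := y)) \<in> (\<Pi>\<^sub>M j\<in>{..<p}. borel) \<Otimes>\<^sub>M borel \<rightarrow>\<^sub>M (\<Pi>\<^sub>M j\<in>insert p {..<p}. borel :: real measure)"
    using measurable_add_dim[of p "{..<p}" "\<lambda>_. borel"] by simp
  have upd': "(\<lambda>w. (f w)(p := g w)) \<in> M \<rightarrow>\<^sub>M (\<Pi>\<^sub>M j\<in>insert p {..<p}. borel :: real measure)"
    if [measurable]: "f \<in> M \<rightarrow>\<^sub>M (\<Pi>\<^sub>M j\<in>{..<p}. borel)" "g \<in> borel_measurable M" for f g and M :: "'z measure"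
    using measurable_compose[OF measurable_Pair[OF that] upd] by simp
  note [measurable] = upd'
  interpret stdn: prob_space stdn by (rule prob_space_stdn)
  have G [measurable]: "G \<in> borel_measurable (\<Pi>\<^sub>M j\<in>{..<p}. borel)"
    unfolding G_def by measurable
  have "emeasure (mvn (Suc p) (rcov p s t v)) A = (\<integral>\<^sup>+x. dens x * indicator A x \<partial>(\<Pi>\<^sub>M j\<in>insert p {..<p}. lborel))"
    unfolding mvn_def lessThan_Suc mvn_density_rcov[OF s t] m_def[symmetric] dens_eq[symmetric]
    by (rule emeasure_density) (use A in \<open>simp_all add: sets_PiM_lborel cong: measurable_cong_sets\<close>)
  also have "\<dots> = (\<integral>\<^sup>+x. (\<integral>\<^sup>+y. dens (x(p := y)) * indicator A (x(p := y)) \<partial>lborel) \<partial>(\<Pi>\<^sub>M j\<in>{..<p}. lborel))"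
    by (rule L.product_nn_integral_insert) auto
  also have "\<dots> = (\<integral>\<^sup>+x. ennreal (\<Prod>j<p. normal_density 0 (sqrt s) (x j)) * G x \<partial>(\<Pi>\<^sub>M j\<in>{..<p}. lborel))"
  proof (rule nn_integral_cong)
    fix x :: "nat \<Rightarrow> real" assume x: "x \<in> space (\<Pi>\<^sub>M j\<in>{..<p}. lborel)"
    then have x' [measurable]: "x \<in> space (\<Pi>\<^sub>M j\<in>{..<p}. borel)" by (simp add: space_PiM)
    let ?c = "ennreal (\<Prod>j<p. normal_density 0 (sqrt s) (x j))"
    have "(\<lambda>y. x(p := y)) \<in> borel \<rightarrow>\<^sub>M (\<Pi>\<^sub>M j\<in>insert p {..<p}. borel :: real measure)"
      using x' by (intro upd') auto
    note [measurable] = this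
    have mx: "m (x(p := y)) = m x" for y unfolding m_def by (intro sum.cong) auto
    have "(\<integral>\<^sup>+y. dens (x(p := y)) * indicator A (x(p := y)) \<partial>lborel) =
       (\<integral>\<^sup>+y. ?c * (ennreal (normal_density (m x) (sqrt t) y) * indicator A (x(p := y))) \<partial>lborel)"
    proof (rule nn_integral_cong)
      fix y
      have "(\<Prod>j<p. normal_density 0 (sqrt s) ((x(p := y)) j)) = (\<Prod>j<p. normal_density 0 (sqrt s) (x j))"
        by (intro prod.cong) auto
      then show "dens (x(p := y)) * indicator A (x(p := y)) =
          ?c * (ennreal (normal_density (m x) (sqrt t) y) * indicator A (x(p := y)))"
        by (simp add: dens_def mx mult.assoc)
    qed
    also have "\<dots> = ?c * (\<integral>\<^sup>+y. ennreal (normal_density (m x) (sqrt t) y) * indicator A (x(p := y)) \<partial>lborel)"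
      by (rule nn_integral_cmult) measurable
    also have "(\<integral>\<^sup>+y. ennreal (normal_density (m x) (sqrt t) y) * indicator A (x(p := y)) \<partial>lborel) =
      ennreal \<bar>sqrt t\<bar> * (\<integral>\<^sup>+e. ennreal (normal_density (m x) (sqrt t) (m x + sqrt t * e)) * indicator A (x(p := m x + sqrt t * e)) \<partial>lborel)"
      using t by (intro nn_integral_real_affine) auto
    also have "\<dots> = (\<integral>\<^sup>+e. ennreal \<bar>sqrt t\<bar> * (ennreal (normal_density (m x) (sqrt t) (m x + sqrt t * e)) * indicator A (x(p := m x + sqrt t * e))) \<partial>lborel)"
      by (rule nn_integral_cmult[symmetric]) measurable
    also have "\<dots> = (\<integral>\<^sup>+e. ennreal (std_normal_density e) * indicator A (x(p := m x + sqrt t * e)) \<partial>lborel)"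
    proof (rule nn_integral_cong)
      fix e
      have "sqrt t * normal_density (m x) (sqrt t) (m x + sqrt t * e) = std_normal_density e"
        using t by (simp add: normal_density_def power_mult_distrib real_sqrt_mult)
      then have "ennreal \<bar>sqrt t\<bar> * ennreal (normal_density (m x) (sqrt t) (m x + sqrt t * e)) = ennreal (std_normal_density e)"
        using t by (simp add: ennreal_mult[symmetric])
      then show "ennreal \<bar>sqrt t\<bar> * (ennreal (normal_density (m x) (sqrt t) (m x + sqrt t * e)) * indicator A (x(p := m x + sqrt t * e))) =
         ennreal (std_normal_density e) * indicator A (x(p := m x + sqrt t * e))"
        by (simp add: mult.assoc[symmetric])
    qed
    also have "\<dots> = G x"
      unfolding G_def stdn_def by (rule nn_integral_density[symmetric]) measurable
    finally show "(\<integral>\<^sup>+y. dens (x(p := y)) * indicator A (x(p := y)) \<partial>lborel) = ?c * G x" .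
  qed
  also have "\<dots> = (\<integral>\<^sup>+x. G (\<lambda>j\<in>{..<p}. sqrt s * x j) \<partial>(\<Pi>\<^sub>M j\<in>{..<p}. stdn))"
    by (rule nn_integral_PiM_normal[OF s]) auto
  also have "\<dots> = (\<integral>\<^sup>+x. (\<integral>\<^sup>+e. indicator A (mix_row p s t v (x(p := e))) \<partial>stdn) \<partial>(\<Pi>\<^sub>M j\<in>{..<p}. stdn))"
  proof (rule nn_integral_cong)
    fix x :: "nat \<Rightarrow> real"
    have "(\<lambda>j\<in>{..<p}. sqrt s * x j)(p := m (\<lambda>j\<in>{..<p}. sqrt s * x j) + sqrt t * e) = mix_row p s t v (x(p := e))" for e
      by (auto simp: mix_row_def m_def fun_eq_iff intro!: sum.cong)
    then show "G (\<lambda>j\<in>{..<p}. sqrt s * x j) = (\<integral>\<^sup>+e. indicator A (mix_row p s t v (x(p := e))) \<partial>stdn)"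
      unfolding G_def by simp
  qed
  also have "\<dots> = (\<integral>\<^sup>+x. indicator A (mix_row p s t v x) \<partial>(\<Pi>\<^sub>M j\<in>insert p {..<p}. stdn))"
    using mix_row_measurable[of p s t v, unfolded lessThan_Suc]
    by (intro S.product_nn_integral_insert[symmetric]) auto
  also have "\<dots> = emeasure (distr (\<Pi>\<^sub>M j\<in>{..<Suc p}. stdn) (\<Pi>\<^sub>M j\<in>{..<Suc p}. borel) (mix_row p s t v)) A"
  proof -
    have A': "A \<in> sets (\<Pi>\<^sub>M j\<in>{..<Suc p}. borel)" using A by (simp add: lessThan_Suc)
    have "emeasure (distr (\<Pi>\<^sub>M j\<in>{..<Suc p}. stdn) (\<Pi>\<^sub>M j\<in>{..<Suc p}. borel) (mix_row p s t v)) A =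
        (\<integral>\<^sup>+x. indicator A x \<partial>distr (\<Pi>\<^sub>M j\<in>{..<Suc p}. stdn) (\<Pi>\<^sub>M j\<in>{..<Suc p}. borel) (mix_row p s t v))"
      using A' by simp
    also have "\<dots> = (\<integral>\<^sup>+x. indicator A (mix_row p s t v x) \<partial>(\<Pi>\<^sub>M j\<in>{..<Suc p}. stdn))"
      using A' mix_row_measurable_stdn by (intro nn_integral_distr) simp_all
    finally show ?thesis by (simp add: lessThan_Suc)
  qed
  finally show "emeasure (mvn (Suc p) (rcov p s t v)) A =
     emeasure (distr (\<Pi>\<^sub>M j\<in>{..<Suc p}. stdn) (\<Pi>\<^sub>M j\<in>{..<Suc p}. borel) (mix_row p s t v)) A" .
qed

text \<open>\<open>sample_law\<close> is a product over rows, whereas the argument separates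
  columns, design from noise. One flat product over index pairs permits both groupings; the rows are
  independent in it because they read disjoint sets of coordinates.\<close>

lemma sample_law_rcov:
  assumes s: "0 < s" and t: "0 < t" and n: "0 < n"
  shows "sample_law n (Suc p) (rcov p s t v) =
    distr (\<Pi>\<^sub>M r\<in>{..<n} \<times> {..<Suc p}. stdn) (sample_space n (Suc p))
      (\<lambda>\<omega>. \<lambda>i\<in>{..<n}. mix_row p s t v (\<lambda>j\<in>{..<Suc p}. \<omega> (i, j)))"
proof -
  let ?K = "{..<n} \<times> {..<Suc p}" and ?J = "{..<Suc p}"
  let ?G = "\<Pi>\<^sub>M r\<in>?K. stdn"
  interpret G: prob_space ?G by (rule prob_space_PiM_stdn)
  interpret S: product_prob_space "\<lambda>_. stdn" by (rule product_prob_space_stdn)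
  define X where "X i \<omega> = mix_row p s t v (\<lambda>j\<in>?J. \<omega> (i, j))" for i :: nat and \<omega> :: "nat \<times> nat \<Rightarrow> real"
  have "distr ?G ?G (\<lambda>\<omega>. \<lambda>r\<in>?K. \<omega> r) = ?G"
    by (rule trans[OF _ distr_id])
       (intro distr_cong refl, auto simp: space_PiM PiE_iff extensional_def)
  moreover have "(\<Pi>\<^sub>M r\<in>?K. distr ?G stdn (\<lambda>\<omega>. \<omega> r)) = ?G"
    by (intro PiM_cong refl distr_PiM_component prob_space_stdn)
  ultimately have "distr ?G ?G (\<lambda>\<omega>. \<lambda>r\<in>?K. \<omega> r) = (\<Pi>\<^sub>M r\<in>?K. distr ?G stdn (\<lambda>\<omega>. \<omega> r))"
    by simp
  then have "G.indep_vars (\<lambda>_. stdn) (\<lambda>r \<omega>. \<omega> r) ?K"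
    using n by (subst G.indep_vars_iff_distr_eq_PiM') auto
  then have "G.indep_vars (\<lambda>i. \<Pi>\<^sub>M r\<in>{i} \<times> ?J. stdn) (\<lambda>i \<omega>. restrict (\<lambda>r. \<omega> r) ({i} \<times> ?J)) {..<n}"
    by (rule G.indep_vars_restrict) (auto simp: disjoint_family_on_def)
  then have "G.indep_vars (\<lambda>i. \<Pi>\<^sub>M j\<in>?J. borel)
      (\<lambda>i \<omega>. mix_row p s t v (\<lambda>j\<in>?J. restrict (\<lambda>r. \<omega> r) ({i} \<times> ?J) (i, j))) {..<n}"
  proof (rule G.indep_vars_compose2)
    fix i
    show "(\<lambda>\<rho>. mix_row p s t v (\<lambda>j\<in>?J. \<rho> (i, j))) \<in> (\<Pi>\<^sub>M r\<in>{i} \<times> ?J. stdn) \<rightarrow>\<^sub>M (\<Pi>\<^sub>M j\<in>?J. borel)"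
    proof (intro measurable_compose[OF _ mix_row_measurable] measurable_restrict)
      fix j assume "j \<in> ?J"
      then have "(i, j) \<in> {i} \<times> ?J" by simp
      then show "(\<lambda>\<rho>. \<rho> (i, j)) \<in> borel_measurable (\<Pi>\<^sub>M r\<in>{i} \<times> ?J. stdn)"
        by measurable
    qed
  qed
  also have "(\<lambda>i \<omega>. mix_row p s t v (\<lambda>j\<in>?J. restrict (\<lambda>r. \<omega> r) ({i} \<times> ?J) (i, j))) = X"
    unfolding X_def by (intro ext arg_cong[of _ _ "mix_row p s t v"]) auto
  finally have ind: "G.indep_vars (\<lambda>i. \<Pi>\<^sub>M j\<in>?J. borel) X {..<n}" .
  have row: "(\<lambda>\<omega>. \<lambda>j\<in>?J. \<omega> (i, j)) \<in> ?G \<rightarrow>\<^sub>M (\<Pi>\<^sub>M j\<in>?J. stdn)" if "i < n" for i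
    by (intro measurable_restrict measurable_component_singleton) (use that in auto)
  have X: "X i \<in> ?G \<rightarrow>\<^sub>M (\<Pi>\<^sub>M j\<in>?J. borel)" if "i < n" for i
    unfolding X_def by (rule measurable_compose[OF row[OF that] mix_row_measurable_stdn])
  have "distr ?G (\<Pi>\<^sub>M i\<in>{..<n}. \<Pi>\<^sub>M j\<in>?J. borel) (\<lambda>\<omega>. \<lambda>i\<in>{..<n}. X i \<omega>) =
      (\<Pi>\<^sub>M i\<in>{..<n}. distr ?G (\<Pi>\<^sub>M j\<in>?J. borel) (X i))"
    using ind n X by (subst (asm) G.indep_vars_iff_distr_eq_PiM') auto
  also have "\<dots> = (\<Pi>\<^sub>M i\<in>{..<n}. mvn (Suc p) (rcov p s t v))"
  proof (intro PiM_cong refl)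
    fix i assume i: "i \<in> {..<n}"
    have "distr ?G (\<Pi>\<^sub>M j\<in>?J. borel) (X i) =
        distr (distr ?G (\<Pi>\<^sub>M j\<in>?J. stdn) (\<lambda>\<omega>. \<lambda>j\<in>?J. \<omega> (i, j))) (\<Pi>\<^sub>M j\<in>?J. borel) (mix_row p s t v)"
      using i row[of i] by (subst distr_distr) (auto simp: X_def[abs_def] comp_def)
    also have "distr ?G (\<Pi>\<^sub>M j\<in>?J. stdn) (\<lambda>\<omega>. \<lambda>j\<in>?J. \<omega> (i, j)) = (\<Pi>\<^sub>M j\<in>?J. stdn)"
      using i by (intro S.distr_reorder) (auto simp: inj_on_def)
    finally show "distr ?G (\<Pi>\<^sub>M j\<in>?J. borel) (X i) = mvn (Suc p) (rcov p s t v)"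
      by (simp add: mvn_rcov[OF s t])
  qed
  finally show ?thesis
    by (simp add: sample_law_def sample_space_def X_def)
qed

section \<open>Indistinguishability of the two mixtures\<close>

text \<open>The factor 1 / sqrt s cancels the scale of the last regressor, so h has the same effect
  for every s. The other slopes are not rescaled, which is why the shift of b that compensates h
  shrinks with s.\<close>

definition slopes :: "nat \<Rightarrow> real \<Rightarrow> real \<Rightarrow> (nat \<Rightarrow> real) \<Rightarrow> nat \<Rightarrow> real" where
  "slopes k s h b l = (if l < k then b l else h / sqrt s)"

definition sample_map ::
  "nat \<Rightarrow> nat \<Rightarrow> real \<Rightarrow> real \<Rightarrow> real \<Rightarrow> (nat \<Rightarrow> real) \<Rightarrow> (nat \<times> nat \<Rightarrow> real) \<Rightarrow> nat \<Rightarrow> nat \<Rightarrow> real" where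
  "sample_map n k s t h b \<omega> = (\<lambda>i\<in>{..<n}.
     mix_row (Suc k) s t (slopes k s h b) (\<lambda>j\<in>{..<Suc (Suc k)}. \<omega> (i, j)))"

lemma sample_map_measurable:
  assumes f: "f \<in> M \<rightarrow>\<^sub>M (\<Pi>\<^sub>M l\<in>{..<k}. borel)"
    and g: "g \<in> M \<rightarrow>\<^sub>M (\<Pi>\<^sub>M r\<in>{..<n} \<times> {..<Suc (Suc k)}. borel)"
  shows "(\<lambda>x. sample_map n k s t h (f x) (g x)) \<in> M \<rightarrow>\<^sub>M sample_space n (Suc (Suc k))"
  unfolding sample_map_def sample_space_def
proof (rule measurable_restrict)
  fix i assume i: "i \<in> {..<n}"
  have g': "(\<lambda>x. g x (i, j)) \<in> borel_measurable M" if "j < Suc (Suc k)" for j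
    using i that by (intro measurable_compose[OF g measurable_component_singleton]) auto
  have f': "(\<lambda>x. slopes k s h (f x) l) \<in> borel_measurable M" for l
    unfolding slopes_def by (cases "l < k") (auto intro!: measurable_compose[OF f measurable_component_singleton])
  show "(\<lambda>x. mix_row (Suc k) s t (slopes k s h (f x)) (\<lambda>j\<in>{..<Suc (Suc k)}. g x (i, j))) \<in>
      M \<rightarrow>\<^sub>M (\<Pi>\<^sub>M j\<in>{..<Suc (Suc k)}. borel)"
    unfolding mix_row_def
  proof (rule measurable_restrict)
    fix j assume "j \<in> {..<Suc (Suc k)}"
    then show "(\<lambda>x. if j < Suc k then sqrt s * (\<lambda>j\<in>{..<Suc (Suc k)}. g x (i, j)) j
        else (\<Sum>l<Suc k. slopes k s h (f x) l * (sqrt s * (\<lambda>j\<in>{..<Suc (Suc k)}. g x (i, j)) l))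
          + sqrt t * (\<lambda>j\<in>{..<Suc (Suc k)}. g x (i, j)) (Suc k)) \<in> borel_measurable M"
      using g' f'
      by (cases "j < Suc k")
         (auto intro!: borel_measurable_add borel_measurable_sum borel_measurable_times)
  qed
qed

text \<open>Columns below k generate \<open>Z\<close>, column k generates \<open>x\<close>, and
  column \<open>Suc k\<close> is the noise.\<close>

abbreviation "design_ix n k \<equiv> {..<n} \<times> {..<Suc k}"
abbreviation "noise_ix n k \<equiv> {..<n} \<times> {Suc k}"

text \<open>An identity between samples, not merely between laws, valid for each \<open>w\<close>.
  It can thus be used at a fixed design z with a \<open>w\<close> adapted to z.\<close>

lemma sample_map_shift:
  fixes b w :: "nat \<Rightarrow> real"
  assumes s: "0 < s" and t: "0 < t"
  shows "sample_map n k s t \<beta> b (merge (design_ix n k) (noise_ix n k) (z, e)) =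
    sample_map n k s t 0 (\<lambda>l\<in>{..<k}. b l + \<beta> * w l / sqrt s)
      (merge (design_ix n k) (noise_ix n k)
        (z, \<lambda>r\<in>noise_ix n k. e r + \<beta> / sqrt t * (z (fst r, k) - (\<Sum>l<k. w l * z (fst r, l)))))"
    (is "sample_map n k s t \<beta> b (?m e) = sample_map n k s t 0 ?b (?m ?e)")
proof -
  have row: "mix_row (Suc k) s t (slopes k s \<beta> b) (\<lambda>j\<in>{..<Suc (Suc k)}. ?m e (i, j)) =
     mix_row (Suc k) s t (slopes k s 0 ?b) (\<lambda>j\<in>{..<Suc (Suc k)}. ?m ?e (i, j))" if i: "i < n" for i
  proof -
    have m: "?m e' (i, j) = (if j < Suc k then z (i, j) else e' (i, j))" if "j < Suc (Suc k)" for e' j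
      using i that by (auto simp: merge_def)
    have "(\<Sum>l<k. (b l + \<beta> * w l / sqrt s) * (sqrt s * z (i, l))) =
        (\<Sum>l<k. b l * (sqrt s * z (i, l)) + \<beta> * (w l * z (i, l)))"
      using s by (intro sum.cong refl) (simp add: field_simps)
    also have "\<dots> = (\<Sum>l<k. b l * (sqrt s * z (i, l))) + \<beta> * (\<Sum>l<k. w l * z (i, l))"
      by (simp add: sum.distrib sum_distrib_left)
    finally have "(\<Sum>l<k. (b l + \<beta> * w l / sqrt s) * (sqrt s * z (i, l))) + sqrt t * (e (i, Suc k) +
           \<beta> / sqrt t * (z (i, k) - (\<Sum>l<k. w l * z (i, l)))) =
        (\<Sum>l<k. b l * (sqrt s * z (i, l))) + \<beta> * z (i, k) + sqrt t * e (i, Suc k)"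
      using t by (simp add: field_simps)
    then show ?thesis
      using s i by (auto simp: mix_row_def slopes_def m fun_eq_iff)
  qed
  show ?thesis
    unfolding sample_map_def by (intro restrict_ext row) (rule lessThan_iff[THEN iffD1])
qed

definition design_prob ::
  "nat \<Rightarrow> nat \<Rightarrow> real \<Rightarrow> real \<Rightarrow> (nat \<Rightarrow> nat \<Rightarrow> real) set \<Rightarrow> real \<Rightarrow> (nat \<Rightarrow> real) \<Rightarrow> (nat \<times> nat \<Rightarrow> real) \<Rightarrow> ennreal" where
  "design_prob n k s t N h b z =
    (\<integral>\<^sup>+e. indicator N (sample_map n k s t h b (merge (design_ix n k) (noise_ix n k) (z, e)))
      \<partial>(\<Pi>\<^sub>M r\<in>noise_ix n k. stdn))"

definition mixed_prob ::
  "nat \<Rightarrow> nat \<Rightarrow> real \<Rightarrow> real \<Rightarrow> (nat \<Rightarrow> nat \<Rightarrow> real) set \<Rightarrow> real \<Rightarrow> (nat \<times> nat \<Rightarrow> real) \<Rightarrow> ennreal" where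
  "mixed_prob n k s t N h z =
    (\<integral>\<^sup>+b. design_prob n k s t N h b z * indicator (unit_cube {..<k}) b \<partial>(\<Pi>\<^sub>M l\<in>{..<k}. lborel))"

section \<open>Averaging over noise, slopes and design: measurability and Fubini\<close>

lemma merge_measurable_borel:
  assumes "f \<in> M \<rightarrow>\<^sub>M (\<Pi>\<^sub>M r\<in>I. borel)" "g \<in> M \<rightarrow>\<^sub>M (\<Pi>\<^sub>M r\<in>J. borel :: real measure)"
  shows "(\<lambda>x. merge I J (f x, g x)) \<in> M \<rightarrow>\<^sub>M (\<Pi>\<^sub>M r\<in>I \<union> J. borel)"
  using measurable_compose[OF measurable_Pair[OF assms] measurable_merge] by simp

lemma design_noise_ix: "design_ix n k \<union> noise_ix n k = {..<n} \<times> {..<Suc (Suc k)}"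
  by auto

lemma unit_cube_sets [measurable]:
  "finite J \<Longrightarrow> unit_cube J \<in> sets (\<Pi>\<^sub>M j\<in>J. borel)"
  by (intro sets_PiM_I_finite) auto

lemma sample_map_merge_measurable:
  assumes "N \<in> sets (sample_space n (Suc (Suc k)))"
    and f: "f \<in> M \<rightarrow>\<^sub>M (\<Pi>\<^sub>M l\<in>{..<k}. borel)"
    and g: "g \<in> M \<rightarrow>\<^sub>M (\<Pi>\<^sub>M r\<in>design_ix n k. borel)"
    and e: "e \<in> M \<rightarrow>\<^sub>M (\<Pi>\<^sub>M r\<in>noise_ix n k. borel)"
  shows "(\<lambda>x. indicator N (sample_map n k s t h (f x) (merge (design_ix n k) (noise_ix n k) (g x, e x))) :: ennreal)
    \<in> borel_measurable M"
  using assms merge_measurable_borel[OF g e, unfolded design_noise_ix]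
  by (intro measurable_compose[OF sample_map_measurable borel_measurable_indicator]) auto

lemma design_prob_measurable:
  assumes N: "N \<in> sets (sample_space n (Suc (Suc k)))"
    and f: "f \<in> M \<rightarrow>\<^sub>M (\<Pi>\<^sub>M l\<in>{..<k}. borel)"
    and g: "g \<in> M \<rightarrow>\<^sub>M (\<Pi>\<^sub>M r\<in>design_ix n k. borel)"
  shows "(\<lambda>x. design_prob n k s t N h (f x) (g x)) \<in> borel_measurable M"
proof -
  interpret prob_space "\<Pi>\<^sub>M r\<in>noise_ix n k. stdn" by (rule prob_space_PiM_stdn)
  have "(\<lambda>x. snd x) \<in> M \<Otimes>\<^sub>M (\<Pi>\<^sub>M r\<in>noise_ix n k. stdn) \<rightarrow>\<^sub>M (\<Pi>\<^sub>M r\<in>noise_ix n k. borel)"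
    using measurable_snd[of M "\<Pi>\<^sub>M r\<in>noise_ix n k. stdn"] measurable_cong_sets[OF refl sets_PiM_stdn] by blast
  then show ?thesis
    unfolding design_prob_def
    by (intro borel_measurable_nn_integral)
       (simp add: case_prod_beta' sample_map_merge_measurable[OF N measurable_compose[OF measurable_fst f]
          measurable_compose[OF measurable_fst g]])
qed

lemma design_prob_le_1: "design_prob n k s t N h b z \<le> 1"
proof -
  interpret prob_space "\<Pi>\<^sub>M r\<in>noise_ix n k. stdn" by (rule prob_space_PiM_stdn)
  have "design_prob n k s t N h b z \<le> (\<integral>\<^sup>+e. 1 \<partial>(\<Pi>\<^sub>M r\<in>noise_ix n k. stdn))"
    unfolding design_prob_def by (intro nn_integral_mono) (auto simp: indicator_def)
  then show ?thesis by (simp add: emeasure_space_1)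
qed

lemma emeasure_unit_cube: "finite J \<Longrightarrow> emeasure (\<Pi>\<^sub>M j\<in>J. lborel) (unit_cube J) = 1"
  by (subst product_sigma_finite.emeasure_PiM[OF product_sigma_finite_lborel]) auto

lemma unit_cube_sets_lborel [measurable]:
  "finite J \<Longrightarrow> unit_cube J \<in> sets (\<Pi>\<^sub>M j\<in>J. lborel)"
  using unit_cube_sets sets_PiM_lborel by blast

lemma mixed_prob_measurable:
  assumes N: "N \<in> sets (sample_space n (Suc (Suc k)))"
  shows "mixed_prob n k s t N h \<in> borel_measurable (\<Pi>\<^sub>M r\<in>design_ix n k. stdn)"
proof -
  let ?M1 = "\<Pi>\<^sub>M r\<in>design_ix n k. stdn" and ?MB = "\<Pi>\<^sub>M l\<in>{..<k}. lborel :: real measure"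
  interpret L: product_sigma_finite "\<lambda>_. lborel :: real measure" by (rule product_sigma_finite_lborel)
  interpret sigma_finite_measure ?MB by (rule L.sigma_finite) simp
  have "(\<lambda>x. design_prob n k s t N h (snd x) (fst x)) \<in> borel_measurable (?M1 \<Otimes>\<^sub>M ?MB)"
    using measurable_fst[of ?M1 ?MB] measurable_snd[of ?M1 ?MB]
      measurable_cong_sets[OF refl sets_PiM_stdn] measurable_cong_sets[OF refl sets_PiM_lborel]
    by (intro design_prob_measurable[OF N]) blast+
  then have "(\<lambda>x. design_prob n k s t N h (snd x) (fst x) * indicator (unit_cube {..<k}) (snd x)) \<in> borel_measurable (?M1 \<Otimes>\<^sub>M ?MB)"
    by (intro borel_measurable_times_ennreal measurable_compose[OF measurable_snd borel_measurable_indicator]) auto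
  then show ?thesis
    unfolding mixed_prob_def[abs_def] by (intro borel_measurable_nn_integral) (simp add: case_prod_beta')
qed

lemma emeasure_sample_law_rcov:
  assumes N: "N \<in> sets (sample_space n (Suc (Suc k)))" and s: "0 < s" and t: "0 < t" and n: "0 < n"
    and b: "b \<in> space (\<Pi>\<^sub>M l\<in>{..<k}. lborel)"
  shows "emeasure (sample_law n (Suc (Suc k)) (rcov (Suc k) s t (slopes k s h b))) N =
    (\<integral>\<^sup>+z. design_prob n k s t N h b z \<partial>(\<Pi>\<^sub>M r\<in>design_ix n k. stdn))"
proof -
  let ?G = "\<Pi>\<^sub>M r\<in>{..<n} \<times> {..<Suc (Suc k)}. stdn"
  interpret S: product_sigma_finite "\<lambda>_. stdn" by (rule product_sigma_finite_stdn)
  have b': "b \<in> space (\<Pi>\<^sub>M l\<in>{..<k}. borel)" using b by (simp add: space_PiM)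
  have id: "(\<lambda>\<omega>. \<omega>) \<in> ?G \<rightarrow>\<^sub>M (\<Pi>\<^sub>M r\<in>{..<n} \<times> {..<Suc (Suc k)}. borel)"
    using measurable_ident measurable_cong_sets[OF refl sets_PiM_stdn] unfolding id_def by blast
  have m: "sample_map n k s t h b \<in> ?G \<rightarrow>\<^sub>M sample_space n (Suc (Suc k))"
    using b' by (intro sample_map_measurable[OF _ id] measurable_const)
  have m': "(\<lambda>\<omega>. indicator N (sample_map n k s t h b \<omega>) :: ennreal) \<in> borel_measurable ?G"
    using N by (intro measurable_compose[OF m borel_measurable_indicator])
  have "emeasure (sample_law n (Suc (Suc k)) (rcov (Suc k) s t (slopes k s h b))) N =
     emeasure (distr ?G (sample_space n (Suc (Suc k))) (sample_map n k s t h b)) N"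
    unfolding sample_law_rcov[OF s t n] sample_map_def[abs_def] ..
  also have "\<dots> = (\<integral>\<^sup>+x. indicator N x \<partial>distr ?G (sample_space n (Suc (Suc k))) (sample_map n k s t h b))"
    using N by simp
  also have "\<dots> = (\<integral>\<^sup>+\<omega>. indicator N (sample_map n k s t h b \<omega>) \<partial>?G)"
    using N m by (intro nn_integral_distr) auto
  also have "\<dots> = (\<integral>\<^sup>+z. design_prob n k s t N h b z \<partial>(\<Pi>\<^sub>M r\<in>design_ix n k. stdn))"
    unfolding design_prob_def design_noise_ix[symmetric]
    by (rule S.product_nn_integral_fold) (use m' in \<open>auto simp: design_noise_ix\<close>)
  finally show ?thesis .
qed

lemma design_prob_pair_measurable:
  assumes N: "N \<in> sets (sample_space n (Suc (Suc k)))"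
  shows "(\<lambda>(b, z). design_prob n k s t N h b z) \<in>
    borel_measurable ((\<Pi>\<^sub>M l\<in>{..<k}. lborel) \<Otimes>\<^sub>M (\<Pi>\<^sub>M r\<in>design_ix n k. stdn))"
  unfolding case_prod_beta'
  using measurable_fst measurable_snd
    measurable_cong_sets[OF refl sets_PiM_stdn] measurable_cong_sets[OF refl sets_PiM_lborel]
  by (intro design_prob_measurable[OF N]) blast+

lemma emeasure_sample_law_rcov_measurable:
  assumes N: "N \<in> sets (sample_space n (Suc (Suc k)))" and s: "0 < s" and t: "0 < t" and n: "0 < n"
  shows "(\<lambda>b. emeasure (sample_law n (Suc (Suc k)) (rcov (Suc k) s t (slopes k s h b))) N)
    \<in> borel_measurable (\<Pi>\<^sub>M l\<in>{..<k}. lborel)"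
proof -
  interpret sigma_finite_measure "\<Pi>\<^sub>M r\<in>design_ix n k. stdn"
    by (rule prob_space_imp_sigma_finite[OF prob_space_PiM_stdn])
  have "(\<lambda>b. \<integral>\<^sup>+z. design_prob n k s t N h b z \<partial>(\<Pi>\<^sub>M r\<in>design_ix n k. stdn))
      \<in> borel_measurable (\<Pi>\<^sub>M l\<in>{..<k}. lborel)"
    by (rule borel_measurable_nn_integral[OF design_prob_pair_measurable[OF N]])
  then show ?thesis
    by (subst measurable_cong[OF emeasure_sample_law_rcov[OF N s t n]])
qed

text \<open>Fubini: the prior on b, outermost in Le Cam's method, moves inside the design. Only then
  may the translation of b depend on z.\<close>

lemma nn_integral_sample_law:
  assumes N: "N \<in> sets (sample_space n (Suc (Suc k)))" and s: "0 < s" and t: "0 < t" and n: "0 < n"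
  shows "(\<integral>\<^sup>+b. emeasure (sample_law n (Suc (Suc k)) (rcov (Suc k) s t (slopes k s h b))) N
      * indicator (unit_cube {..<k}) b \<partial>(\<Pi>\<^sub>M l\<in>{..<k}. lborel)) =
    (\<integral>\<^sup>+z. mixed_prob n k s t N h z \<partial>(\<Pi>\<^sub>M r\<in>design_ix n k. stdn))"
proof -
  let ?M1 = "\<Pi>\<^sub>M r\<in>design_ix n k. stdn" and ?MB = "\<Pi>\<^sub>M l\<in>{..<k}. lborel :: real measure"
  interpret L: product_sigma_finite "\<lambda>_. lborel :: real measure" by (rule product_sigma_finite_lborel)
  interpret B: sigma_finite_measure ?MB by (rule L.sigma_finite) simp
  interpret M1: sigma_finite_measure ?M1
    by (rule prob_space_imp_sigma_finite[OF prob_space_PiM_stdn])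
  interpret P: pair_sigma_finite ?MB ?M1 ..
  have meas: "(\<lambda>(b, z). design_prob n k s t N h b z * indicator (unit_cube {..<k}) b) \<in> borel_measurable (?MB \<Otimes>\<^sub>M ?M1)"
    using design_prob_pair_measurable[OF N] unfolding case_prod_beta'
    by (intro borel_measurable_times_ennreal measurable_compose[OF measurable_fst borel_measurable_indicator]) auto
  have "(\<integral>\<^sup>+b. emeasure (sample_law n (Suc (Suc k)) (rcov (Suc k) s t (slopes k s h b))) N
      * indicator (unit_cube {..<k}) b \<partial>?MB) =
    (\<integral>\<^sup>+b. (\<integral>\<^sup>+z. design_prob n k s t N h b z * indicator (unit_cube {..<k}) b \<partial>?M1) \<partial>?MB)"
  proof (rule nn_integral_cong)
    fix b assume b: "b \<in> space ?MB"
    have "design_prob n k s t N h b \<in> borel_measurable ?M1"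
      using measurable_Pair2[OF design_prob_pair_measurable[OF N] b] by simp
    then show "emeasure (sample_law n (Suc (Suc k)) (rcov (Suc k) s t (slopes k s h b))) N * indicator (unit_cube {..<k}) b =
       (\<integral>\<^sup>+z. design_prob n k s t N h b z * indicator (unit_cube {..<k}) b \<partial>?M1)"
      unfolding emeasure_sample_law_rcov[OF N s t n b] by (rule nn_integral_multc[symmetric])
  qed
  also have "\<dots> = (\<integral>\<^sup>+z. mixed_prob n k s t N h z \<partial>?M1)"
    unfolding mixed_prob_def by (rule P.Fubini'[OF meas, symmetric])
  finally show ?thesis .
qed

text \<open>Starting from slope 0, b is translated at the cost of cube volume, then the noise at the
  cost of \<open>nn_integral_PiM_stdn_translation_le_quadratic\<close>. After both translations
  \<open>sample_map_shift\<close> recognises the sample with slope \<beta>.\<close>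

lemma mixed_prob_le:
  assumes N: "N \<in> sets (sample_space n (Suc (Suc k)))" and s: "0 < s" and t: "0 < t"
    and z: "z \<in> space (\<Pi>\<^sub>M r\<in>design_ix n k. stdn)"
    and w: "\<And>l. l < k \<Longrightarrow> \<bar>\<beta> * w l / sqrt s\<bar> \<le> 1"
  shows "mixed_prob n k s t N 0 z \<le> mixed_prob n k s t N \<beta> z
    + ennreal (1 - (\<Prod>l<k. 1 - \<bar>\<beta> * w l / sqrt s\<bar>))
    + ennreal (1 / 8 + 4 * (\<beta>\<^sup>2 / t * (\<Sum>i<n. (z (i, k) - (\<Sum>l<k. w l * z (i, l)))\<^sup>2)))"
proof -
  let ?M2 = "\<Pi>\<^sub>M r\<in>noise_ix n k. stdn" and ?MB = "\<Pi>\<^sub>M l\<in>{..<k}. lborel :: real measure"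
  let ?m = "\<lambda>e. merge (design_ix n k) (noise_ix n k) (z, e)"
  define r where "r q = \<beta> / sqrt t * (z (fst q, k) - (\<Sum>l<k. w l * z (fst q, l)))" for q :: "nat \<times> nat"
  define c where "c = ennreal (1 / 8 + 4 * (\<beta>\<^sup>2 / t * (\<Sum>i<n. (z (i, k) - (\<Sum>l<k. w l * z (i, l)))\<^sup>2)))"
  have z': "z \<in> space (\<Pi>\<^sub>M r\<in>design_ix n k. borel)" using z by (simp add: space_PiM)
  have idB: "(\<lambda>b. b) \<in> (\<Pi>\<^sub>M l\<in>{..<k}. borel :: real measure) \<rightarrow>\<^sub>M (\<Pi>\<^sub>M l\<in>{..<k}. borel)" by simp
  have cm: "(\<lambda>b. design_prob n k s t N h b z) \<in> borel_measurable (\<Pi>\<^sub>M l\<in>{..<k}. borel)" for h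
    using z' by (intro design_prob_measurable[OF N idB] measurable_const)
  then have cm': "(\<lambda>b. design_prob n k s t N h b z) \<in> borel_measurable ?MB" for h
    using measurable_cong_sets[OF sets_PiM_lborel refl] by blast
  have r2: "(\<Sum>q\<in>noise_ix n k. (r q)\<^sup>2) = \<beta>\<^sup>2 / t * (\<Sum>i<n. (z (i, k) - (\<Sum>l<k. w l * z (i, l)))\<^sup>2)"
  proof -
    have "(\<Sum>q\<in>noise_ix n k. (r q)\<^sup>2) = (\<Sum>i<n. (r (i, Suc k))\<^sup>2)"
      by (rule sum.reindex_bij_witness[of _ "\<lambda>i. (i, Suc k)" fst]) auto
    also have "\<dots> = (\<Sum>i<n. \<beta>\<^sup>2 / t * (z (i, k) - (\<Sum>l<k. w l * z (i, l)))\<^sup>2)"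
      using t by (simp add: r_def power_mult_distrib power_divide)
    finally show ?thesis by (simp add: sum_distrib_left)
  qed
  have shift: "design_prob n k s t N 0 (\<lambda>l\<in>{..<k}. b l + \<beta> * w l / sqrt s) z \<le> design_prob n k s t N \<beta> b z + c" for b
  proof -
    let ?b = "\<lambda>l\<in>{..<k}. b l + \<beta> * w l / sqrt s"
    have m: "(\<lambda>e. indicator N (sample_map n k s t 0 ?b (?m e)) :: ennreal) \<in> borel_measurable (\<Pi>\<^sub>M r\<in>noise_ix n k. borel)"
      using z' by (intro sample_map_merge_measurable[OF N] measurable_const) (auto simp: space_PiM)
    have "design_prob n k s t N 0 ?b z \<le>
        (\<integral>\<^sup>+e. indicator N (sample_map n k s t 0 ?b (?m (\<lambda>q\<in>noise_ix n k. e q + r q))) \<partial>?M2)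
          + ennreal (1 / 8 + 4 * (\<Sum>q\<in>noise_ix n k. (r q)\<^sup>2))"
      unfolding design_prob_def
      by (rule nn_integral_PiM_stdn_translation_le_quadratic[OF _ m]) (auto simp: indicator_def)
    also have "(\<integral>\<^sup>+e. indicator N (sample_map n k s t 0 ?b (?m (\<lambda>q\<in>noise_ix n k. e q + r q))) \<partial>?M2) =
        design_prob n k s t N \<beta> b z"
      unfolding design_prob_def sample_map_shift[OF s t, where b = b and w = w] r_def ..
    finally show ?thesis unfolding r2 c_def .
  qed
  have "mixed_prob n k s t N 0 z \<le>
      (\<integral>\<^sup>+b. design_prob n k s t N 0 (\<lambda>l\<in>{..<k}. b l + \<beta> * w l / sqrt s) z * indicator (unit_cube {..<k}) b \<partial>?MB)
       + ennreal (1 - (\<Prod>l<k. 1 - \<bar>\<beta> * w l / sqrt s\<bar>))"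
    unfolding mixed_prob_def
    by (rule nn_integral_unit_cube_translation_le[OF _ cm design_prob_le_1]) (use w in auto)
  also have "(\<integral>\<^sup>+b. design_prob n k s t N 0 (\<lambda>l\<in>{..<k}. b l + \<beta> * w l / sqrt s) z * indicator (unit_cube {..<k}) b \<partial>?MB)
     \<le> (\<integral>\<^sup>+b. design_prob n k s t N \<beta> b z * indicator (unit_cube {..<k}) b + c * indicator (unit_cube {..<k}) b \<partial>?MB)"
    using shift by (intro nn_integral_mono) (auto simp: indicator_def)
  also have "\<dots> = mixed_prob n k s t N \<beta> z + c"
    using cm' by (subst nn_integral_add) (auto simp: mixed_prob_def emeasure_unit_cube nn_integral_cmult_indicator)
  finally show ?thesis
    unfolding c_def by (simp add: ac_simps)
qed

section \<open>Letting the variance of the regressors tend to infinity\<close>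

lemma ennreal_le_diff_add: "x \<le> (x - y) + (y :: ennreal)"
  using ennreal_minus_le_iff[of x y "x - y"] by (simp add: add.commute)

lemma mixed_prob_le_1: "mixed_prob n k s t N h z \<le> 1"
proof -
  have "mixed_prob n k s t N h z \<le> (\<integral>\<^sup>+b. indicator (unit_cube {..<k}) b \<partial>(\<Pi>\<^sub>M l\<in>{..<k}. lborel))"
    unfolding mixed_prob_def using design_prob_le_1
    by (intro nn_integral_mono) (auto simp: indicator_def)
  then show ?thesis by (simp add: emeasure_unit_cube)
qed

text \<open>The cube translation has vanishing cost as \<open>s\<close> grows; the Gaussian one does not depend on \<open>s\<close>.\<close>

lemma limsup_mixed_prob_diff_le:
  assumes N: "N \<in> sets (sample_space n (Suc (Suc k)))" and t: "0 < t" and s0: "0 < s0"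
    and z: "z \<in> space (\<Pi>\<^sub>M r\<in>design_ix n k. stdn)"
  shows "limsup (\<lambda>i. mixed_prob n k (s0 + real i) t N 0 z - mixed_prob n k (s0 + real i) t N \<beta> z)
    \<le> ennreal (1 / 8 + 4 * (\<beta>\<^sup>2 / t * (\<Sum>i<n. (z (i, k) - (\<Sum>l<k. w l * z (i, l)))\<^sup>2)))"
    (is "limsup ?u \<le> ?c")
proof -
  let ?d = "\<lambda>i l. \<bar>\<beta> * w l / sqrt (s0 + real i)\<bar>"
  have lim: "(\<lambda>i. ?d i l) \<longlonglongrightarrow> 0" for l
  proof -
    have "filterlim (\<lambda>i. s0 + real i) at_top sequentially"
      by (rule filterlim_tendsto_add_at_top[OF tendsto_const filterlim_real_sequentially])
    then have "(\<lambda>i. \<beta> * w l / sqrt (s0 + real i)) \<longlonglongrightarrow> 0"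
      by (intro real_tendsto_divide_at_top[OF tendsto_const] filterlim_compose[OF sqrt_at_top])
    then show ?thesis by (rule tendsto_rabs_zero)
  qed
  have box: "(\<lambda>i. 1 - (\<Prod>l<k. 1 - ?d i l)) \<longlonglongrightarrow> 0"
  proof -
    have "(\<lambda>i. 1 - (\<Prod>l<k. 1 - ?d i l)) \<longlonglongrightarrow> 1 - (\<Prod>l<k. 1 - 0)"
      by (intro tendsto_intros lim)
    then show ?thesis by simp
  qed
  \<comment> \<open>The cube lemma asks for shifts of size at most 1 in every coordinate, which
    holds for all large i.\<close>
  have "\<forall>l\<in>{..<k}. eventually (\<lambda>i. ?d i l < 1) sequentially"
    using lim by (auto intro!: order_tendstoD(2))
  then have ev: "eventually (\<lambda>i. \<forall>l\<in>{..<k}. ?d i l < 1) sequentially"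
    by (simp add: eventually_ball_finite)
  have "limsup ?u \<le> limsup (\<lambda>i. ennreal (1 - (\<Prod>l<k. 1 - ?d i l)) + ?c)"
  proof (rule Limsup_mono)
    show "eventually (\<lambda>i. ?u i \<le> ennreal (1 - (\<Prod>l<k. 1 - ?d i l)) + ?c) sequentially"
      using ev
    proof eventually_elim
      case (elim i)
      have "mixed_prob n k (s0 + real i) t N 0 z \<le> mixed_prob n k (s0 + real i) t N \<beta> z
          + (ennreal (1 - (\<Prod>l<k. 1 - ?d i l)) + ?c)"
        using mixed_prob_le[OF N _ t z, of "s0 + real i" \<beta> w] elim s0 by (force simp: add.assoc less_imp_le)
      then show ?case
        by (intro ennreal_minus_le_iff[THEN iffD2] conjI impI)
           (use mixed_prob_le_1[of n k "s0 + real i" t N \<beta> z] in \<open>auto simp: top_unique\<close>)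
    qed
  qed
  also have "\<dots> = ennreal 0 + ?c"
    by (intro lim_imp_Limsup tendsto_add tendsto_ennrealI box tendsto_const) simp
  finally show ?thesis by simp
qed

text \<open>One inequality suffices, as the interval has to miss the alternative value rarely under
  the null mixture. The expected excess has a limit superior of at most 1/8 + 1/16; being strictly
  below 1/4, it is below 1/4 already for some finite s.\<close>

theorem mixtures_indistinguishable:
  assumes N: "N \<in> sets (sample_space n (Suc (Suc k)))" and t: "0 < t" and s0: "0 < s0"
    and n: "0 < n" and k: "k \<le> n" and \<beta>: "64 * \<beta>\<^sup>2 * (real n - real k) \<le> t"
  shows "\<exists>s\<ge>s0.
    (\<integral>\<^sup>+b. emeasure (sample_law n (Suc (Suc k)) (rcov (Suc k) s t (slopes k s 0 b))) N
        * indicator (unit_cube {..<k}) b \<partial>(\<Pi>\<^sub>M l\<in>{..<k}. lborel)) \<le>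
    (\<integral>\<^sup>+b. emeasure (sample_law n (Suc (Suc k)) (rcov (Suc k) s t (slopes k s \<beta> b))) N
        * indicator (unit_cube {..<k}) b \<partial>(\<Pi>\<^sub>M l\<in>{..<k}. lborel)) + ennreal (1 / 4)"
proof -
  let ?M = "\<Pi>\<^sub>M r\<in>design_ix n k. stdn"
  interpret M: prob_space ?M by (rule prob_space_PiM_stdn)
  define F where "F h i = mixed_prob n k (s0 + real i) t N h" for h i
  define u where "u i z = F 0 i z - F \<beta> i z" for i z
  have F [measurable]: "F h i \<in> borel_measurable ?M" for h i
    unfolding F_def by (rule mixed_prob_measurable[OF N])
  have u [measurable]: "u i \<in> borel_measurable ?M" for i
    unfolding u_def by measurable
  \<comment> \<open>Free of \<open>w\<close>, measurable, and below \<gamma> times the residual sum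
    of squares for every \<open>w\<close>: up to scaling this is the minorant that
    \<open>nn_integral_least_squares_le\<close> expects.\<close>
  define h where "h z = limsup (\<lambda>i. u i z) - ennreal (1 / 8)" for z
  have h [measurable]: "h \<in> borel_measurable ?M"
    unfolding h_def by measurable
  define \<gamma> where "\<gamma> = 4 * (\<beta>\<^sup>2 / t)"
  have \<gamma>: "0 \<le> \<gamma>" using t by (simp add: \<gamma>_def)
  have h_le: "h z \<le> ennreal \<gamma> * ennreal (\<Sum>i<n. (z (i, k) - (\<Sum>l<k. w l * z (i, l)))\<^sup>2)" if z: "z \<in> space ?M" for z w
  proof -
    define q where "q = (\<Sum>i<n. (z (i, k) - (\<Sum>l<k. w l * z (i, l)))\<^sup>2)"
    have q: "0 \<le> q" by (simp add: q_def sum_nonneg)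
    have "limsup (\<lambda>i. u i z) \<le> ennreal (1 / 8 + \<gamma> * q)"
      using limsup_mixed_prob_diff_le[OF N t s0 z, of \<beta> w]
      by (simp add: u_def F_def q_def \<gamma>_def mult.assoc)
    also have "\<dots> = ennreal (1 / 8) + ennreal (\<gamma> * q)"
      using \<gamma> q by (intro ennreal_plus) auto
    finally have "h z \<le> ennreal (\<gamma> * q)"
      unfolding h_def by (simp add: ennreal_minus_le_iff add.commute)
    then show ?thesis using \<gamma> q by (simp add: q_def ennreal_mult)
  qed
  have h_int: "(\<integral>\<^sup>+z. h z \<partial>?M) \<le> ennreal (1 / 16)"
  \<comment> \<open>Rescaling \<open>h\<close> by 1 / \<gamma> needs \<gamma> > 0; for \<gamma> = 0
    the bound on \<open>h\<close> is already 0.\<close>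
  proof (cases "\<gamma> = 0")
    case True
    then have "(\<integral>\<^sup>+z. h z \<partial>?M) \<le> (\<integral>\<^sup>+z. 0 \<partial>?M)"
      using h_le by (intro nn_integral_mono) force
    then show ?thesis by simp
  next
    case False
    then have g0: "0 < \<gamma>" using \<gamma> by simp
    have ix: "{..<n} \<times> insert k {..<k} = design_ix n k" by auto
    have "(\<integral>\<^sup>+z. ennreal (1 / \<gamma>) * h z \<partial>?M) \<le> ennreal (real n - card {..<k})"
    proof (rule nn_integral_least_squares_le[of "{..<k}" k n "\<lambda>z. ennreal (1 / \<gamma>) * h z", unfolded ix])
      fix z w assume z: "z \<in> space ?M"
      have "ennreal (1 / \<gamma>) * h z \<le> ennreal (1 / \<gamma>) * (ennreal \<gamma> * ennreal (\<Sum>i<n. (z (i, k) - (\<Sum>j<k. w j * z (i, j)))\<^sup>2))"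
        by (intro mult_left_mono h_le z) simp
      also have "\<dots> = ennreal (\<Sum>i<n. (z (i, k) - (\<Sum>j<k. w j * z (i, j)))\<^sup>2)"
        using g0 by (simp add: mult.assoc[symmetric] ennreal_mult[symmetric])
      finally show "ennreal (1 / \<gamma>) * h z \<le> \<dots>" .
    qed (use k in auto)
    then have le: "ennreal (1 / \<gamma>) * (\<integral>\<^sup>+z. h z \<partial>?M) \<le> ennreal (real n - real k)"
      by (simp add: nn_integral_cmult)
    have "(\<integral>\<^sup>+z. h z \<partial>?M) = ennreal \<gamma> * (ennreal (1 / \<gamma>) * (\<integral>\<^sup>+z. h z \<partial>?M))"
      using g0 by (simp add: mult.assoc[symmetric] ennreal_mult[symmetric])
    also have "\<dots> \<le> ennreal \<gamma> * ennreal (real n - real k)"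
      by (intro mult_left_mono le) simp
    also have "\<dots> = ennreal (\<gamma> * (real n - real k))"
      using \<gamma> k by (simp add: ennreal_mult)
    \<comment> \<open>The 64 in the hypothesis on \<beta> meets the 4 in \<gamma>: 4/64 =
      1/16.\<close>
    also have "\<dots> \<le> ennreal (1 / 16)"
      using \<beta> t by (intro ennreal_leI) (simp add: \<gamma>_def field_simps)
    finally show ?thesis .
  qed
  \<comment> \<open>Reverse Fatou; the constant 1 dominates and is integrable under a probability
    measure.\<close>
  have "limsup (\<lambda>i. \<integral>\<^sup>+z. u i z \<partial>?M) \<le> (\<integral>\<^sup>+z. limsup (\<lambda>i. u i z) \<partial>?M)"
  proof (rule nn_integral_limsup[where w = "\<lambda>_. 1"])
    show "AE z in ?M. u i z \<le> 1" for i
      unfolding u_def F_def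
      by (intro AE_I2 order_trans[OF diff_le_self_ennreal mixed_prob_le_1])
  qed (auto simp: M.emeasure_space_1)
  also have "\<dots> \<le> (\<integral>\<^sup>+z. h z + ennreal (1 / 8) \<partial>?M)"
    unfolding h_def by (intro nn_integral_mono) (rule ennreal_le_diff_add)
  also have "\<dots> = (\<integral>\<^sup>+z. h z \<partial>?M) + ennreal (1 / 8)"
    by (subst nn_integral_add) (auto simp: M.emeasure_space_1)
  also have "\<dots> \<le> ennreal (1 / 16) + ennreal (1 / 8)"
    by (intro add_right_mono h_int)
  also have "\<dots> < ennreal (1 / 4)"
    by (simp add: ennreal_plus[symmetric] ennreal_less_iff del: ennreal_plus)
  finally have "eventually (\<lambda>i. (\<integral>\<^sup>+z. u i z \<partial>?M) < ennreal (1 / 4)) sequentially"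
    by (rule Limsup_lessD)
  then obtain i where i: "(\<integral>\<^sup>+z. u i z \<partial>?M) < ennreal (1 / 4)"
    by (auto simp: eventually_sequentially)
  have "(\<integral>\<^sup>+z. F 0 i z \<partial>?M) \<le> (\<integral>\<^sup>+z. F \<beta> i z + u i z \<partial>?M)"
    unfolding u_def add.commute[of "F \<beta> i _"] by (intro nn_integral_mono) (rule ennreal_le_diff_add)
  also have "\<dots> = (\<integral>\<^sup>+z. F \<beta> i z \<partial>?M) + (\<integral>\<^sup>+z. u i z \<partial>?M)"
    by (rule nn_integral_add) measurable
  also have "\<dots> \<le> (\<integral>\<^sup>+z. F \<beta> i z \<partial>?M) + ennreal (1 / 4)"
    using i by (intro add_left_mono) simp
  finally show ?thesis
    using s0 unfolding F_def
    by (intro exI[of _ "s0 + real i"]) (simp add: nn_integral_sample_law[OF N _ t n])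
qed

section \<open>The minimax lower bound\<close>

lemma width_ge:
  assumes "x \<in> S" "y \<in> S"
  shows "ennreal (x - y) \<le> width S"
proof -
  have "ereal x \<le> Sup (ereal ` S)" "Inf (ereal ` S) \<le> ereal y"
    using assms by (auto intro: Sup_upper Inf_lower)
  then have "ereal x - ereal y \<le> Sup (ereal ` S) - Inf (ereal ` S)"
    by (rule ereal_minus_mono)
  then have "e2ennreal (ereal (x - y)) \<le> width S"
    unfolding width_def by (intro e2ennreal_mono) simp
  then show ?thesis by (simp add: e2ennreal_ereal)
qed

lemma conf_sets_noncoverage:
  assumes C: "CI \<in> conf_sets \<alpha> a n D" and S: "S \<in> cov_class D a" and P: "prob_space (sample_law n D S)"
  shows "emeasure (sample_law n D S) {X \<in> space (sample_space n D). theta D S \<notin> CI X} \<le> ennreal \<alpha>"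
proof -
  interpret P: prob_space "sample_law n D S" by (rule P)
  let ?A = "{X \<in> space (sample_space n D). theta D S \<in> CI X}"
  have A: "?A \<in> P.events" "1 - \<alpha> \<le> P.prob ?A"
    using C S by (auto simp: conf_sets_def sets_sample_law)
  have "{X \<in> space (sample_space n D). theta D S \<notin> CI X} = space (sample_law n D S) - ?A"
    by (auto simp: space_sample_law)
  then have "P.prob {X \<in> space (sample_space n D). theta D S \<notin> CI X} \<le> \<alpha>"
    using A P.prob_compl[OF A(1)] by simp
  then show ?thesis
    by (simp add: P.emeasure_eq_measure ennreal_leI)
qed

lemma prob_space_sample_law_rcov:
  assumes "0 < s" "0 < t" "0 < n"
  shows "prob_space (sample_law n (Suc (Suc k)) (rcov (Suc k) s t (slopes k s h b)))"
proof -
  interpret prob_space "\<Pi>\<^sub>M r\<in>{..<n} \<times> {..<Suc (Suc k)}. stdn" by (rule prob_space_PiM_stdn)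
  \<comment> \<open>\<open>slopes\<close> reads b only below k, and the restriction lies in the
    extensional product space that measurability refers to.\<close>
  define b' where "b' = restrict b {..<k}"
  have "slopes k s h b = slopes k s h b'" by (auto simp: slopes_def b'_def fun_eq_iff)
  moreover have "(\<lambda>\<omega>. \<omega>) \<in> (\<Pi>\<^sub>M r\<in>{..<n} \<times> {..<Suc (Suc k)}. stdn) \<rightarrow>\<^sub>M (\<Pi>\<^sub>M r\<in>{..<n} \<times> {..<Suc (Suc k)}. borel)"
    using measurable_ident measurable_cong_sets[OF refl sets_PiM_stdn] unfolding id_def by blast
  then have "sample_map n k s t h b' \<in> (\<Pi>\<^sub>M r\<in>{..<n} \<times> {..<Suc (Suc k)}. stdn) \<rightarrow>\<^sub>M sample_space n (Suc (Suc k))"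
    by (intro sample_map_measurable measurable_const) (auto simp: b'_def space_PiM)
  then have "prob_space (distr (\<Pi>\<^sub>M r\<in>{..<n} \<times> {..<Suc (Suc k)}. stdn) (sample_space n (Suc (Suc k))) (sample_map n k s t h b'))"
    by (rule prob_space_distr)
  ultimately show ?thesis
    unfolding sample_law_rcov[OF assms] sample_map_def[abs_def] by simp
qed

text \<open>An interval containing both 0 and \<theta> has width at least \<theta>. Under the null
  mixture it misses 0 with probability at most \<alpha> and \<theta> with probability at most
  \<alpha> + 1/4, so the mean squared width is at least \<open>\<theta>\<^sup>2\<close> (1 - 2
  \<alpha> - 1/4) for the mixture, hence in the supremum.\<close>

lemma minimax_width_lower_bound:
  assumes \<alpha>: "0 < \<alpha>" "\<alpha> < 1 / 4" and a: "0 < a" and kn: "Suc (Suc k) \<le> n"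
    and C: "CI \<in> conf_sets \<alpha> a n (Suc (Suc k))"
  shows "ennreal (1 / (520 * (real n - real (Suc (Suc k)) + 1))) \<le>
    (SUP \<Sigma>\<in>cov_class (Suc (Suc k)) a. \<integral>\<^sup>+X. (width (CI X))\<^sup>2 \<partial>sample_law n (Suc (Suc k)) \<Sigma>)"
    (is "_ \<le> ?R")
proof -
  let ?D = "Suc (Suc k)"
  let ?MB = "\<Pi>\<^sub>M l\<in>{..<k}. lborel :: real measure"
  define m where "m = real n - real k"
  have m: "2 \<le> m" using kn by (simp add: m_def)
  \<comment> \<open>The squared slopes sum to at most k + 1: each b_l lies in [0, 1], and the last
    slope has square at most 1 by the choice of s0.\<close>
  define t where "t = a * (1 + 2 * (real k + 1))"
  have t: "0 < t" using a by (simp add: t_def)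
  \<comment> \<open>The largest value that \<open>mixtures_indistinguishable\<close> admits.\<close>
  define \<beta> where "\<beta> = sqrt (t / (64 * m))"
  have \<beta>2: "\<beta>\<^sup>2 = t / (64 * m)" using t m by (simp add: \<beta>_def)
  have \<beta>0: "0 < \<beta>" using t m by (simp add: \<beta>_def)
  \<comment> \<open>The term 2 a is required by \<open>rcov_in_cov_class\<close>; the term
    \<open>\<beta>\<^sup>2\<close> makes the last slope at most 1.\<close>
  define s0 where "s0 = 2 * a + \<beta>\<^sup>2"
  have s0: "0 < s0" using a by (simp add: s0_def add_pos_nonneg)
  define \<theta> where "\<theta> = \<beta> / sqrt (t + \<beta>\<^sup>2)"
  have \<theta>2: "\<theta>\<^sup>2 = 1 / (64 * m + 1)"
  proof -
    have "\<theta>\<^sup>2 = \<beta>\<^sup>2 / (t + \<beta>\<^sup>2)" using t by (simp add: \<theta>_def power_divide add_pos_nonneg less_imp_le)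
    also have "t + \<beta>\<^sup>2 = \<beta>\<^sup>2 * (64 * m + 1)" unfolding \<beta>2 using m by (simp add: field_simps)
    also have "\<beta>\<^sup>2 / (\<beta>\<^sup>2 * (64 * m + 1)) = 1 / (64 * m + 1)" using \<beta>0 by simp
    finally show ?thesis .
  qed
  have \<theta>0: "0 \<le> \<theta>" using \<beta>0 t by (simp add: \<theta>_def)
  define S where "S s h b = rcov (Suc k) s t (slopes k s h b)" for s h b
  have S_class: "S s h b \<in> cov_class ?D a" if s: "s0 \<le> s" and h: "h\<^sup>2 \<le> \<beta>\<^sup>2" and b: "b \<in> unit_cube {..<k}" for s h b
  proof -
    have sp: "0 < s" using s s0 by linarith
    have "(\<Sum>l<Suc k. (slopes k s h b l)\<^sup>2) = (\<Sum>l<k. (b l)\<^sup>2) + h\<^sup>2 / s"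
      using sp by (simp add: slopes_def power_divide)
    also have "\<dots> \<le> (\<Sum>l<k. 1) + 1"
    proof (intro add_mono sum_mono)
      show "(b l)\<^sup>2 \<le> 1" if "l \<in> {..<k}" for l
        using b that by (auto simp: PiE_iff intro!: power_le_one)
      have "h\<^sup>2 \<le> s" using h s a by (simp add: s0_def)
      then show "h\<^sup>2 / s \<le> 1" using sp by simp
    qed
    finally have "a * (1 + 2 * (\<Sum>l<Suc k. (slopes k s h b l)\<^sup>2)) \<le> t"
      unfolding t_def using a by (intro mult_left_mono) auto
    moreover have "2 * a \<le> s" using s by (simp add: s0_def add_increasing2 order_trans[OF _ s])
    ultimately show ?thesis unfolding S_def by (intro rcov_in_cov_class a)
  qed
  have theta_S: "theta ?D (S s h b) = h / sqrt (t + h\<^sup>2)" if "0 < s" for s h b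
    unfolding S_def theta_rcov[OF that t] using that by (simp add: slopes_def power_divide)
  \<comment> \<open>The target value depends on neither b nor s. A single event therefore serves the
    whole cube and is available before s is chosen.\<close>
  define N where "N h = {X \<in> space (sample_space n ?D). h / sqrt (t + h\<^sup>2) \<notin> CI X}" for h
  \<comment> \<open>Any point of the cube would do: measurability of the event is read off the
    coverage condition at one covariance matrix.\<close>
  define b0 where "b0 = (\<lambda>l\<in>{..<k}. 0 :: real)"
  have b0: "b0 \<in> unit_cube {..<k}" by (auto simp: b0_def)
  have N_sets: "N h \<in> sets (sample_space n ?D)" if h: "h\<^sup>2 \<le> \<beta>\<^sup>2" for h
  proof -
    have "{X \<in> space (sample_space n ?D). h / sqrt (t + h\<^sup>2) \<in> CI X} \<in> sets (sample_space n ?D)"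
      using C S_class[OF order_refl h b0] theta_S[OF s0, of h b0] by (force simp: conf_sets_def)
    moreover have "N h = space (sample_space n ?D) - {X \<in> space (sample_space n ?D). h / sqrt (t + h\<^sup>2) \<in> CI X}"
      by (auto simp: N_def)
    ultimately show ?thesis by auto
  qed
  obtain s where s: "s0 \<le> s" and mix:
    "(\<integral>\<^sup>+b. emeasure (sample_law n ?D (S s 0 b)) (N \<beta>) * indicator (unit_cube {..<k}) b \<partial>?MB) \<le>
     (\<integral>\<^sup>+b. emeasure (sample_law n ?D (S s \<beta> b)) (N \<beta>) * indicator (unit_cube {..<k}) b \<partial>?MB) + ennreal (1 / 4)"
    using mixtures_indistinguishable[OF N_sets[of \<beta>] t s0, of \<beta>] kn m t unfolding S_def
    by (auto simp: \<beta>2 m_def field_simps)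
  have sp: "0 < s" using s s0 by linarith
  have n: "0 < n" using kn by simp
  have P: "prob_space (sample_law n ?D (S s h b))" for h b
    unfolding S_def by (rule prob_space_sample_law_rcov[OF sp t n])
  have cover: "emeasure (sample_law n ?D (S s h b)) (N h) \<le> ennreal \<alpha>"
    if "h\<^sup>2 \<le> \<beta>\<^sup>2" "b \<in> unit_cube {..<k}" for h b
    using conf_sets_noncoverage[OF C S_class[OF s that] P]
    by (simp add: N_def theta_S[OF sp])
  \<comment> \<open>Kept in additive form, because ?R may be infinite and subtraction in
    \<open>ennreal\<close> truncates.\<close>
  have point: "ennreal (\<theta>\<^sup>2) \<le> ?R + ennreal (\<theta>\<^sup>2) * ennreal \<alpha> + ennreal (\<theta>\<^sup>2) * emeasure (sample_law n ?D (S s 0 b)) (N \<beta>)"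
    if b: "b \<in> unit_cube {..<k}" for b
  proof -
    let ?P = "sample_law n ?D (S s 0 b)"
    interpret P: prob_space ?P by (rule P)
    have W: "(\<lambda>X. (width (CI X))\<^sup>2) \<in> borel_measurable ?P"
      using C unfolding conf_sets_def
      by (auto simp: measurable_cong_sets[OF sets_sample_law refl] power2_eq_square intro!: borel_measurable_times_ennreal)
    have N0: "N 0 \<in> sets ?P" "N \<beta> \<in> sets ?P"
      using N_sets[of 0] N_sets[of \<beta>] by (simp_all add: sets_sample_law)
    have "ennreal (\<theta>\<^sup>2) = (\<integral>\<^sup>+X. ennreal (\<theta>\<^sup>2) \<partial>?P)"
      by (simp add: P.emeasure_space_1)
    also have "\<dots> \<le> (\<integral>\<^sup>+X. (width (CI X))\<^sup>2 + (ennreal (\<theta>\<^sup>2) * indicator (N 0) X + ennreal (\<theta>\<^sup>2) * indicator (N \<beta>) X) \<partial>?P)"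
    proof (rule nn_integral_mono)
      fix X assume X: "X \<in> space ?P"
      show "ennreal (\<theta>\<^sup>2) \<le> (width (CI X))\<^sup>2 + (ennreal (\<theta>\<^sup>2) * indicator (N 0) X + ennreal (\<theta>\<^sup>2) * indicator (N \<beta>) X)"
      proof (cases "X \<in> N 0 \<or> X \<in> N \<beta>")
        case True
        then show ?thesis by (auto simp: indicator_def intro: add_increasing add_increasing2)
      next
        case False
        then have "0 \<in> CI X" "\<theta> \<in> CI X" using X by (auto simp: N_def \<theta>_def space_sample_law)
        then have "ennreal \<theta> \<le> width (CI X)" using width_ge[of \<theta> "CI X" 0] by simp
        then have "(ennreal \<theta>)\<^sup>2 \<le> (width (CI X))\<^sup>2" by (intro power_mono) auto
        then show ?thesis using \<theta>0 by (simp add: ennreal_power add_increasing2)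
      qed
    qed
    also have "\<dots> = (\<integral>\<^sup>+X. (width (CI X))\<^sup>2 \<partial>?P) + (ennreal (\<theta>\<^sup>2) * emeasure ?P (N 0) + ennreal (\<theta>\<^sup>2) * emeasure ?P (N \<beta>))"
      using W N0 by (subst nn_integral_add, simp, simp, subst nn_integral_add, simp, simp) (simp add: nn_integral_cmult_indicator)
    also have "\<dots> \<le> ?R + (ennreal (\<theta>\<^sup>2) * ennreal \<alpha> + ennreal (\<theta>\<^sup>2) * emeasure ?P (N \<beta>))"
      using S_class[OF s _ b, of 0] cover[OF _ b, of 0]
      by (intro add_mono SUP_upper mult_left_mono order_refl) auto
    finally show ?thesis by (simp add: add.assoc)
  qed
  have "ennreal (\<theta>\<^sup>2) = (\<integral>\<^sup>+b. ennreal (\<theta>\<^sup>2) * indicator (unit_cube {..<k}) b \<partial>?MB)"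
    by (simp add: nn_integral_cmult_indicator emeasure_unit_cube)
  also have "\<dots> \<le> (\<integral>\<^sup>+b. (?R + ennreal (\<theta>\<^sup>2) * ennreal \<alpha>) * indicator (unit_cube {..<k}) b +
      ennreal (\<theta>\<^sup>2) * (emeasure (sample_law n ?D (S s 0 b)) (N \<beta>) * indicator (unit_cube {..<k}) b) \<partial>?MB)"
    using point by (intro nn_integral_mono) (auto simp: indicator_def)
  also have "\<dots> \<le> (\<integral>\<^sup>+b. (?R + ennreal (\<theta>\<^sup>2) * ennreal \<alpha>) * indicator (unit_cube {..<k}) b \<partial>?MB) +
      ennreal (\<theta>\<^sup>2) * (\<integral>\<^sup>+b. emeasure (sample_law n ?D (S s 0 b)) (N \<beta>) * indicator (unit_cube {..<k}) b \<partial>?MB)"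
    using emeasure_sample_law_rcov_measurable[OF N_sets[of \<beta>] sp t n, of 0] unfolding S_def
    by (subst nn_integral_add, simp, simp, subst nn_integral_cmult) simp_all
  also have "\<dots> \<le> ?R + ennreal (\<theta>\<^sup>2) * ennreal \<alpha> + ennreal (\<theta>\<^sup>2) * (ennreal \<alpha> + ennreal (1 / 4))"
  proof (intro add_mono mult_left_mono)
    have "(\<integral>\<^sup>+b. emeasure (sample_law n ?D (S s \<beta> b)) (N \<beta>) * indicator (unit_cube {..<k}) b \<partial>?MB)
       \<le> (\<integral>\<^sup>+b. ennreal \<alpha> * indicator (unit_cube {..<k}) b \<partial>?MB)"
      using cover[of \<beta>] by (intro nn_integral_mono) (auto simp: indicator_def)
    also have "\<dots> = ennreal \<alpha>" by (simp add: nn_integral_cmult_indicator emeasure_unit_cube)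
    finally show "(\<integral>\<^sup>+b. emeasure (sample_law n ?D (S s 0 b)) (N \<beta>) * indicator (unit_cube {..<k}) b \<partial>?MB)
        \<le> ennreal \<alpha> + ennreal (1 / 4)"
      using mix by (meson add_right_mono order_trans)
  qed (simp_all add: nn_integral_cmult_indicator emeasure_unit_cube)
  also have "\<dots> = ?R + ennreal (\<theta>\<^sup>2 * (2 * \<alpha> + 1 / 4))"
  proof -
    have f1: "ennreal \<alpha> + ennreal (1 / 4) = ennreal (\<alpha> + 1 / 4)"
      using \<alpha> by (intro ennreal_plus[symmetric]) auto
    have f2: "ennreal (\<theta>\<^sup>2) * ennreal \<alpha> = ennreal (\<theta>\<^sup>2 * \<alpha>)"
      "ennreal (\<theta>\<^sup>2) * ennreal (\<alpha> + 1 / 4) = ennreal (\<theta>\<^sup>2 * (\<alpha> + 1 / 4))"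
      using \<alpha> by (intro ennreal_mult[symmetric]; simp)+
    have f3: "ennreal (\<theta>\<^sup>2 * \<alpha>) + ennreal (\<theta>\<^sup>2 * (\<alpha> + 1 / 4)) = ennreal (\<theta>\<^sup>2 * \<alpha> + \<theta>\<^sup>2 * (\<alpha> + 1 / 4))"
      using \<alpha> by (intro ennreal_plus[symmetric]) auto
    have f4: "\<theta>\<^sup>2 * \<alpha> + \<theta>\<^sup>2 * (\<alpha> + 1 / 4) = \<theta>\<^sup>2 * (2 * \<alpha> + 1 / 4)"
      by (simp add: algebra_simps)
    show ?thesis by (simp only: add.assoc f1 f2 f3 f4)
  qed
  finally have fin: "ennreal (\<theta>\<^sup>2) \<le> ?R + ennreal (\<theta>\<^sup>2 * (2 * \<alpha> + 1 / 4))" .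
  have "ennreal (1 / (520 * (real n - real ?D + 1))) \<le> ennreal (\<theta>\<^sup>2 - \<theta>\<^sup>2 * (2 * \<alpha> + 1 / 4))"
  proof (rule ennreal_leI)
    \<comment> \<open>Here n - D + 1 = m - 1, and 520 (m - 1) \<ge> 4 (64 m + 1) as soon as m \<ge>
      2, that is, D \<le> n.\<close>
    have "520 * (real n - real ?D + 1) \<ge> 4 * (64 * m + 1)"
      using m by (simp add: m_def)
    then have "1 / (520 * (real n - real ?D + 1)) \<le> 1 / (4 * (64 * m + 1))"
      using m by (intro divide_left_mono) auto
    also have "\<dots> = \<theta>\<^sup>2 * (1 / 4)" by (simp add: \<theta>2)
    also have "\<dots> \<le> \<theta>\<^sup>2 * (1 - (2 * \<alpha> + 1 / 4))"
      using \<alpha> by (intro mult_left_mono) auto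
    finally show "1 / (520 * (real n - real ?D + 1)) \<le> \<theta>\<^sup>2 - \<theta>\<^sup>2 * (2 * \<alpha> + 1 / 4)"
      by (simp add: algebra_simps)
  qed
  also have "\<dots> = ennreal (\<theta>\<^sup>2) - ennreal (\<theta>\<^sup>2 * (2 * \<alpha> + 1 / 4))"
    using \<alpha> by (intro ennreal_minus[symmetric]) auto
  also have "\<dots> \<le> ?R"
    using fin by (simp add: ennreal_minus_le_iff add.commute)
  finally show ?thesis .
qed

theorem theorem3:
  fixes \<alpha> a :: real and D :: "nat \<Rightarrow> nat"
  assumes "0 < \<alpha>" and "\<alpha> < 1/4" and "0 < a"
    and "\<And>n. 2 \<le> n \<Longrightarrow> 2 \<le> D n \<and> D n \<le> n"
  shows "\<exists>C>0. \<forall>n\<ge>2.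
    ennreal (C / (real n - real (D n) + 1))
      \<le> (INF CI\<in>conf_sets \<alpha> a n (D n).
            SUP \<Sigma>\<in>cov_class (D n) a.
              \<integral>\<^sup>+ X. (width (CI X))\<^sup>2 \<partial>sample_law n (D n) \<Sigma>)"
\<comment> \<open>The constant depends on none of \<alpha>, a, D and n; the infimum is bounded one
  confidence procedure at a time.\<close>
proof (intro exI[of _ "1 / 520"] conjI allI impI INF_greatest)
  fix n CI assume n: "2 \<le> n" and CI: "CI \<in> conf_sets \<alpha> a n (D n)"
  obtain k where k: "D n = Suc (Suc k)"
    using assms(4)[OF n] by (metis Suc_le_D numeral_2_eq_2 Suc_le_mono)
  have "Suc (Suc k) \<le> n" using assms(4)[OF n] k by simp
  from minimax_width_lower_bound[OF assms(1-3) this CI[unfolded k]]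
  show "ennreal (1 / 520 / (real n - real (D n) + 1)) \<le>
      (SUP \<Sigma>\<in>cov_class (D n) a. \<integral>\<^sup>+ X. (width (CI X))\<^sup>2 \<partial>sample_law n (D n) \<Sigma>)"
    by (simp add: k)
qed simp

end
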